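(* Let $B\in O_K$ be a singular semi-primary negative integer, i.e. $B$ is singular and semi-primary, $BO_K=\mathbf b^p$, the class $Cl(\mathbf b)\in C_p^-$ has order $p$ and is annihilated by $\sigma-\mu$, where $\mu=u_{2m+1}$ with $1\le m\le \frac{p-3}{2}$. Then there exist a unit $\eta\in O_{K^+}^*$ and an element $\beta\in O_K$ with $B\overline{B}=\eta\beta^p$ such that $B'=\frac{B^2}{\eta}$ is a singular negative integer satisfying $$\sigma(B')=B'^{\mu}\,\alpha'^{\,p}\quad\text{for some }\alpha'\in K.$$ Moreover, if $B'$ is non-primary, then $\pi^{2m+1}\,\|\,(B')^{p-1}-1$.
   Context: Let $p$ be an odd prime, $\zeta$ a primitive $p$-th root of unity, $K=\mathbb{Q}(\zeta)$, $O_K=\mathbb{Z}[\zeta]$, $K^+=\mathbb{Q}(\zeta+\zeta^{-1})$, with $O_{K^+}^*$ the unit group of $O_{K^+}=\mathbb{Z}[\zeta+\zeta^{-1}]$. Let $\pi=(1-\zeta)O_K$ be the prime ideal over $p$; $\pi^k\,\|\,x$ means that the $\pi$-adic valuation of $x$ is exactly $k$. Let $u$ be a primitive root mod $p$ and $\sigma$ the generator of $\mathrm{Gal}(K/\mathbb{Q})$ with $\sigma(\zeta)=\zeta^u$; $u_i$ denotes the integer with $u_i\equiv u^i \bmod p$, $1\le u_i\le p-1$. The bar is complex conjugation. Elements $\mu\in\mathbf{F}_p^*$ are used as exponents via their representative in $\{1,\dots,p-1\}$. A class $c$ is annihilated by $\sigma-\mu$ if $\sigma(c)=c^\mu$. $C_p$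 is the subgroup of the class group of $K$ killed by $p$, and $C_p^-$ its minus part (classes $c\in C_p$ with $\overline{c}=c^{-1}$). A number $C\in K$ is singular if it is not a $p$-th power in $K$ and $CO_K=\mathbf c^p$ for some (fractional) ideal $\mathbf c$ of $K$; a singular integer is a singular number in $O_K$. A singular number $C$ is primary if $C\equiv c^p \bmod \pi^p$ for some $c\in\mathbb{Z}$ with $c\not\equiv0\bmod p$, and semi-primary if $C\equiv c\bmod\pi^2$ for some $c\in\mathbb{Z}$ with $c\not\equiv 0\bmod p$. A singular integer $B$ with $BO_K=\mathbf b^p$, where $Cl(\mathbf b)$ is annihilated by $\sigma-\mu$ for some $\mu\in\mathbf{F}_p^*$, is called negative if $Cl(\mathbf b)\in C_p^-$. *)

theory Defs
  imports "HOL-Algebra.Coset" "HOL-Number_Theory.Residue_Primitive_Roots"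
    "HOL-Computational_Algebra.Polynomial" Complex_Main
begin

text \<open>
  Everything lives inside the complex numbers: \<open>z\<close> is a primitive \<open>p\<close>-th root of unity and the
  field \<open>K\<close>, its ring of integers and its fractional ideals are sets of complex numbers, so that
  the bar is the function \<open>cnj\<close>.
\<close>

text \<open>Division by zero yields zero in HOL, so no side condition on \<open>g\<close> is needed below.\<close>

definition rat_adjoin :: "complex \<Rightarrow> complex set" where
  "rat_adjoin x = {poly (map_poly of_rat f) x / poly (map_poly of_rat g) x | f g :: rat poly. True}"

definition int_adjoin :: "complex \<Rightarrow> complex set" where
  "int_adjoin x = {poly (map_poly of_int f) x | f :: int poly. True}"

definition cyc_field :: "complex \<Rightarrow> complex set" where
  "cyc_field z = rat_adjoin z"

definition cyc_int :: "complex \<Rightarrow> complex set" where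
  "cyc_int z = int_adjoin z"

definition real_cyc_int :: "complex \<Rightarrow> complex set" where
  "real_cyc_int z = int_adjoin (z + inverse z)"

definition units_in :: "complex set \<Rightarrow> complex set" where
  "units_in R = {x \<in> R. \<exists>y\<in>R. x * y = 1}"

definition galois_aut :: "complex \<Rightarrow> (complex \<Rightarrow> complex) \<Rightarrow> bool" where
  "galois_aut z \<sigma> \<longleftrightarrow>
     bij_betw \<sigma> (cyc_field z) (cyc_field z) \<and>
     (\<forall>x\<in>cyc_field z. \<forall>y\<in>cyc_field z. \<sigma> (x + y) = \<sigma> x + \<sigma> y \<and> \<sigma> (x * y) = \<sigma> x * \<sigma> y) \<and>
     (\<forall>q::rat. \<sigma> (of_rat q) = of_rat q)"


text \<open>Fractional ideals are by convention nonzero.\<close>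

definition fractional_ideal :: "complex \<Rightarrow> complex set \<Rightarrow> bool" where
  "fractional_ideal z I \<longleftrightarrow>
     I \<subseteq> cyc_field z \<and> 0 \<in> I \<and> I \<noteq> {0} \<and>
     (\<forall>x\<in>I. \<forall>y\<in>I. x + y \<in> I) \<and>
     (\<forall>r\<in>cyc_int z. \<forall>x\<in>I. r * x \<in> I) \<and>
     (\<exists>d\<in>cyc_int z. d \<noteq> 0 \<and> (\<forall>x\<in>I. d * x \<in> cyc_int z))"

definition ideal_mult :: "complex set \<Rightarrow> complex set \<Rightarrow> complex set" where
  "ideal_mult I J =
     {\<Sum>i<n. a i * b i | (n::nat) a b. \<forall>i<n. a i \<in> I \<and> b i \<in> J}"

definition ideal_group :: "complex \<Rightarrow> complex set monoid" where
  "ideal_group z =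
     \<lparr>carrier = {I. fractional_ideal z I}, monoid.mult = ideal_mult, one = cyc_int z\<rparr>"

definition princ :: "complex \<Rightarrow> complex \<Rightarrow> complex set" where
  "princ z x = {x * r | r. r \<in> cyc_int z}"

definition principal_ideals :: "complex \<Rightarrow> complex set set" where
  "principal_ideals z = {princ z x | x. x \<in> cyc_field z \<and> x \<noteq> 0}"

definition class_group :: "complex \<Rightarrow> complex set set monoid" where
  "class_group z = ideal_group z Mod principal_ideals z"

definition ideal_class :: "complex \<Rightarrow> complex set \<Rightarrow> complex set set" where
  "ideal_class z I = principal_ideals z #>\<^bsub>ideal_group z\<^esub> I"

text \<open>
  A class is a coset, that is, a set of fractional ideals: an automorphism of \<open>K\<close> acts on it by
  acting on the elements of these ideals.
\<close>

definition act_class :: "(complex \<Rightarrow> complex) \<Rightarrow> complex set set \<Rightarrow> complex set set" where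
  "act_class \<tau> c = (\<lambda>I. \<tau> ` I) ` c"

definition annihilated ::
    "complex \<Rightarrow> (complex \<Rightarrow> complex) \<Rightarrow> nat \<Rightarrow> complex set set \<Rightarrow> bool" where
  "annihilated z \<sigma> \<mu> c \<longleftrightarrow> act_class \<sigma> c = c [^]\<^bsub>class_group z\<^esub> \<mu>"

text \<open>
  This is the property by which \<open>group.ord\<close> is specified; it is stated here without the
  locale assumption that the structure is a group.
\<close>

definition has_order :: "('a, 'b) monoid_scheme \<Rightarrow> 'a \<Rightarrow> nat \<Rightarrow> bool" where
  "has_order G c d \<longleftrightarrow> c \<in> carrier G \<and> (\<forall>n::nat. c [^]\<^bsub>G\<^esub> n = \<one>\<^bsub>G\<^esub> \<longleftrightarrow> d dvd n)"

definition class_p :: "nat \<Rightarrow> complex \<Rightarrow> complex set set set" where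
  "class_p p z =
     {c \<in> carrier (class_group z). c [^]\<^bsub>class_group z\<^esub> p = \<one>\<^bsub>class_group z\<^esub>}"

definition class_p_minus :: "nat \<Rightarrow> complex \<Rightarrow> complex set set set" where
  "class_p_minus p z = {c \<in> class_p p z. act_class cnj c = inv\<^bsub>class_group z\<^esub> c}"


definition pi_ideal :: "complex \<Rightarrow> complex set" where
  "pi_ideal z = princ z (1 - z)"

text \<open>
  The elements of \<open>K\<close> of \<open>\<pi>\<close>-adic valuation at least \<open>k\<close>: the localization at \<open>\<pi>\<close> of the ideal
  \<open>\<pi>\<^sup>k\<close>. Congruences modulo \<open>\<pi>\<^sup>k\<close> between elements of \<open>K\<close> that need not be integral are meant in
  this sense.
\<close>

definition pi_power_loc :: "complex \<Rightarrow> nat \<Rightarrow> complex set" where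
  "pi_power_loc z k =
     {x \<in> cyc_field z. \<exists>d\<in>cyc_int z - pi_ideal z. d * x \<in> pi_ideal z [^]\<^bsub>ideal_group z\<^esub> k}"

definition pi_exactly :: "complex \<Rightarrow> nat \<Rightarrow> complex \<Rightarrow> bool" where
  "pi_exactly z k x \<longleftrightarrow> x \<in> pi_power_loc z k \<and> x \<notin> pi_power_loc z (Suc k)"

definition cong_pi :: "complex \<Rightarrow> nat \<Rightarrow> complex \<Rightarrow> complex \<Rightarrow> bool" where
  "cong_pi z k x y \<longleftrightarrow> x - y \<in> pi_power_loc z k"


definition singular :: "nat \<Rightarrow> complex \<Rightarrow> complex \<Rightarrow> bool" where
  "singular p z C \<longleftrightarrow>
     C \<in> cyc_field z \<and> \<not> (\<exists>x\<in>cyc_field z. C = x ^ p) \<and>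
     (\<exists>I. fractional_ideal z I \<and> princ z C = I [^]\<^bsub>ideal_group z\<^esub> p)"

definition primary :: "nat \<Rightarrow> complex \<Rightarrow> complex \<Rightarrow> bool" where
  "primary p z C \<longleftrightarrow>
     singular p z C \<and> (\<exists>c::int. \<not> int p dvd c \<and> cong_pi z p C (of_int c ^ p))"

definition semi_primary :: "nat \<Rightarrow> complex \<Rightarrow> complex \<Rightarrow> bool" where
  "semi_primary p z C \<longleftrightarrow>
     singular p z C \<and> (\<exists>c::int. \<not> int p dvd c \<and> cong_pi z 2 C (of_int c))"

definition singular_negative_integer ::
    "nat \<Rightarrow> complex \<Rightarrow> (complex \<Rightarrow> complex) \<Rightarrow> complex \<Rightarrow> bool" where
  "singular_negative_integer p z \<sigma> B \<longleftrightarrow>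
     singular p z B \<and> B \<in> cyc_int z \<and>
     (\<exists>I. fractional_ideal z I \<and> princ z B = I [^]\<^bsub>ideal_group z\<^esub> p \<and>
          (\<exists>\<mu>\<in>{1..p - 1}. annihilated z \<sigma> \<mu> (ideal_class z I)) \<and>
          ideal_class z I \<in> class_p_minus p z)"

end

theory Submission
  imports Defs
begin

text \<open>
  Let \<open>\<pi> = 1 - z\<close>. Since \<open>I * cnj I = (g)\<close> is principal, \<open>B * cnj B\<close> is a unit times \<open>g ^ p\<close>, and as \<open>p\<close> is odd
  the unit can be made a power of a relative norm, at the expense of changing \<open>g\<close>; so
  \<open>B * cnj B = \<eta> * \<beta> ^ p\<close> and \<open>B' = B\<^sup>2 / \<eta> = (B / cnj B) * \<beta> ^ p\<close>. The annihilator condition gives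
  \<open>\<sigma> B = e * \<delta> ^ p * B ^ \<mu>\<close> with a unit \<open>e\<close>. As \<open>B\<close> is semi-primary, \<open>e\<close> is congruent to an integer
  modulo \<open>\<pi>\<^sup>2\<close>; by Kronecker's theorem \<open>e / cnj e\<close> is a root of unity, and it is 1 modulo \<open>\<pi>\<^sup>2\<close>,
  hence equal to 1. So \<open>e\<close> cancels in \<open>\<sigma> (B / cnj B)\<close>. Finally \<open>C = B' ^ (p - 1)\<close> is 1 modulo \<open>\<pi>\<close> and
  satisfies \<open>\<sigma> C = C ^ \<mu>\<close> modulo \<open>\<pi> ^ p\<close>. If \<open>C = 1 + \<pi> ^ k * a\<close> with \<open>a\<close> prime to \<open>\<pi>\<close> and \<open>k < p\<close>,
  comparing leading terms gives \<open>u ^ k = \<mu>\<close> modulo \<open>p\<close>, because \<open>\<sigma> \<pi> = u * \<pi>\<close> modulo \<open>\<pi>\<^sup>2\<close>;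
  otherwise \<open>B'\<close> is congruent to \<open>B' ^ p\<close> modulo \<open>\<pi> ^ p\<close> and therefore primary.
\<close>

section \<open>Congruences in subrings\<close>

text \<open>Calculations in the ring run on exponent vectors \<open>ev a k\<close>:
  \<open>\<sigma>\<close> multiplies \<open>k\<close> by \<open>u\<close>, and Fourier inversion
  modulo \<open>p\<close> recovers the coefficients from the conjugates, so rationality, coefficient
  bounds and the action of Frobenius can be read off. Ideals enter through generators of their
  \<open>p\<close>-th powers, which are known up to a unit; the one deeper fact about them is that
  an ideal whose \<open>p\<close>-th power is the unit ideal is itself the unit ideal, and this is
  where integral closure comes in. The precision \<open>\<pi> ^ 2\<close> is dictated by the roots
  of unity: a unit is a real one times a root of unity, and \<open>z\<close> is already 1 modulo
  \<open>\<pi>\<close>, so only the square detects it. The precision \<open>\<pi> ^ p\<close> is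
  dictated by the unknown factor \<open>\<alpha> ^ p\<close>: the \<open>p\<close>-th power of a
  number prime to \<open>\<pi>\<close> is determined modulo \<open>\<pi> ^ p\<close> by its residue
  modulo \<open>\<pi>\<close>, and the outer exponent \<open>p - 1\<close> turns that residue into
  1. Comparing leading terms yields the exponent only modulo \<open>p - 1\<close>; the range
  \<open>0 < n < p - 1\<close> makes it exact.\<close>

locale ring_set =
  fixes R :: "'a :: comm_ring_1 set"
  assumes one_mem [simp, intro]: "1 \<in> R"
    and diff_mem [simp, intro]: "\<And>x y. x \<in> R \<Longrightarrow> y \<in> R \<Longrightarrow> x - y \<in> R"
    and mult_mem [simp, intro]: "\<And>x y. x \<in> R \<Longrightarrow> y \<in> R \<Longrightarrow> x * y \<in> R"
begin

lemma zero_mem [simp, intro]: "0 \<in> R"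
  using diff_mem[OF one_mem one_mem] by simp

lemma uminus_mem [simp, intro]: "x \<in> R \<Longrightarrow> - x \<in> R"
  using diff_mem[OF zero_mem, of x] by simp

lemma add_mem [simp, intro]: "x \<in> R \<Longrightarrow> y \<in> R \<Longrightarrow> x + y \<in> R"
  using diff_mem[of x "- y"] by simp

lemma power_mem [simp, intro]: "x \<in> R \<Longrightarrow> x ^ n \<in> R"
  by (induction n) auto

lemma sum_mem: "(\<And>i. i \<in> A \<Longrightarrow> f i \<in> R) \<Longrightarrow> sum f A \<in> R"
  by (induction A rule: infinite_finite_induct) auto

lemma prod_mem: "(\<And>i. i \<in> A \<Longrightarrow> f i \<in> R) \<Longrightarrow> prod f A \<in> R"
  by (induction A rule: infinite_finite_induct) auto

lemma of_nat_mem [simp, intro]: "of_nat n \<in> R"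
  by (induction n) auto

lemma of_int_mem [simp, intro]: "of_int n \<in> R"
  by (cases n) auto

lemma numeral_mem [simp, intro]: "numeral n \<in> R"
  using of_nat_mem[of "numeral n"] by simp

text \<open>On a field such as the complex numbers \<open>dvd\<close> is trivial, so the quotient
  has to be confined to \<open>R\<close>. A congruence modulo \<open>a\<close> is written
  \<open>dv a (x - y)\<close> throughout.\<close>

definition dv :: "'a \<Rightarrow> 'a \<Rightarrow> bool" where
  "dv a x \<longleftrightarrow> (\<exists>t\<in>R. x = a * t)"

lemma dv_I [intro]: "t \<in> R \<Longrightarrow> dv a (a * t)"
  by (auto simp: dv_def)

lemma dv_E: "dv a x \<Longrightarrow> (\<And>t. t \<in> R \<Longrightarrow> x = a * t \<Longrightarrow> thesis) \<Longrightarrow> thesis"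
  by (auto simp: dv_def)

lemma dv_refl [simp, intro]: "dv a a"
  using dv_I[of 1 a] by simp

lemma dv_0 [simp, intro]: "dv a 0"
  using dv_I[of 0 a] by simp

lemma dv_one [simp, intro]: "x \<in> R \<Longrightarrow> dv 1 x"
  using dv_I[of x 1] by simp

lemma dv_add [intro]: "dv a x \<Longrightarrow> dv a y \<Longrightarrow> dv a (x + y)"
  unfolding dv_def by (metis add_mem distrib_left)

lemma dv_diff [intro]: "dv a x \<Longrightarrow> dv a y \<Longrightarrow> dv a (x - y)"
  unfolding dv_def by (metis diff_mem right_diff_distrib)

lemma dv_minus [simp]: "dv a (- x) \<longleftrightarrow> dv a x"
  using dv_diff[of a 0 x] dv_diff[of a 0 "- x"] by auto

lemma dv_minus_commute: "dv a (x - y) \<longleftrightarrow> dv a (y - x)"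
  using dv_minus[of a "x - y"] by simp

lemma dv_mult [intro]: "dv a x \<Longrightarrow> dv b y \<Longrightarrow> dv (a * b) (x * y)"
  unfolding dv_def by (metis mult_mem mult.assoc mult.left_commute)

lemma dv_mult_left [intro]: "dv a x \<Longrightarrow> t \<in> R \<Longrightarrow> dv a (t * x)"
  using dv_mult[of a x 1 t] by (simp add: mult.commute)

lemma dv_mult_right [intro]: "dv a x \<Longrightarrow> t \<in> R \<Longrightarrow> dv a (x * t)"
  using dv_mult[of a x 1 t] by simp

lemma dv_trans: "dv a b \<Longrightarrow> dv b x \<Longrightarrow> dv a x"
  unfolding dv_def by (metis mult_mem mult.assoc)

lemma dv_power: "dv a x \<Longrightarrow> dv (a ^ n) (x ^ n)"
  by (induction n) auto

lemma dv_power_le: "m \<le> n \<Longrightarrow> a \<in> R \<Longrightarrow> dv (a ^ m) (a ^ n)"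
  unfolding dv_def by (metis le_add_diff_inverse power_add power_mem)

lemma dv_sum: "(\<And>i. i \<in> A \<Longrightarrow> dv a (f i)) \<Longrightarrow> dv a (sum f A)"
  by (induction A rule: infinite_finite_induct) auto

lemma dvc_trans: "dv a (x - y) \<Longrightarrow> dv a (y - w) \<Longrightarrow> dv a (x - w)"
  using dv_add[of a "x - y" "y - w"] by simp

lemma cong_dv_iff: "dv a (x - y) \<Longrightarrow> dv a x \<longleftrightarrow> dv a y"
  using dv_add[of a "x - y" y] dv_diff[of a x "x - y"] by auto

lemma dvc_mult:
  assumes "dv a (x - y)" "dv a (x' - y')" "y \<in> R" "x' \<in> R"
  shows "dv a (x * x' - y * y')"
proof -
  have "x * x' - y * y' = (x - y) * x' + y * (x' - y')"
    by (simp add: algebra_simps)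
  then show ?thesis using assms by auto
qed

lemma dvc_power: "dv a (x - y) \<Longrightarrow> x \<in> R \<Longrightarrow> y \<in> R \<Longrightarrow> dv a (x ^ n - y ^ n)"
  by (induction n) (auto intro: dvc_mult)

lemma binomial_remainder:
  assumes "x \<in> R"
  shows "\<exists>s\<in>R. (1 + x) ^ n = 1 + of_nat n * x + x\<^sup>2 * s"
proof (induction n)
  case 0
  then show ?case by (intro bexI[of _ 0]) auto
next
  case (Suc n)
  then obtain s where s: "s \<in> R" "(1 + x) ^ n = 1 + of_nat n * x + x\<^sup>2 * s" by blast
  have "(1 + x) ^ Suc n = 1 + of_nat (Suc n) * x + x\<^sup>2 * (of_nat n + s + x * s)"
    by (simp add: s(2) algebra_simps power2_eq_square)
  then show ?case using s assms by blast
qed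

text \<open>The inner binomial coefficients are multiples of \<open>q\<close>. The term linear in
  \<open>x\<close> is kept apart from the rest because it is the leading one when \<open>x\<close>
  is divisible by \<open>\<pi>\<close>.\<close>

lemma prime_binomial:
  assumes "prime q" "x \<in> R" "y \<in> R"
  shows "\<exists>s\<in>R. (x + y) ^ q = x ^ q + y ^ q + of_nat q * x * y ^ (q - 1) + of_nat q * x\<^sup>2 * s"
proof -
  have q: "2 \<le> q" using assms(1) by (rule prime_ge_2_nat)
  define f where "f k = of_nat (q choose k) * x ^ k * y ^ (q - k)" for k
  define s where "s = (\<Sum>k\<in>{2..<q}. of_nat ((q choose k) div q) * x ^ (k - 2) * y ^ (q - k))"
  have split: "{..q} = {0, 1, q} \<union> {2..<q}" using q by auto
  have "(x + y) ^ q = sum f {..q}"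
    unfolding f_def by (rule binomial_ring)
  also have "\<dots> = sum f {0, 1, q} + sum f {2..<q}"
    unfolding split by (rule sum.union_disjoint) auto
  also have "sum f {0, 1, q} = x ^ q + y ^ q + of_nat q * x * y ^ (q - 1)"
    using q by (simp add: f_def)
  also have "sum f {2..<q} = of_nat q * x\<^sup>2 * s"
    unfolding s_def sum_distrib_left
  proof (rule sum.cong)
    fix k assume k: "k \<in> {2..<q}"
    then have "q dvd (q choose k)" using assms(1) by (intro dvd_choose_prime) auto
    then have "of_nat (q choose k) = (of_nat q * of_nat ((q choose k) div q) :: 'a)"
      by (metis dvd_mult_div_cancel of_nat_mult)
    moreover have "x ^ k = x\<^sup>2 * x ^ (k - 2)"
      using k by (metis atLeastLessThan_iff le_add_diff_inverse power_add)
    ultimately show "f k = of_nat q * x\<^sup>2 * (of_nat ((q choose k) div q) * x ^ (k - 2) * y ^ (q - k))"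
      by (simp add: f_def mult_ac)
  qed simp
  finally show ?thesis using assms by (intro bexI[of _ s]) (auto simp: s_def intro!: sum_mem)
qed

text \<open>The modulus \<open>q * x\<close> is finer than \<open>q\<close>: for
  \<open>q = p\<close> and \<open>x\<close> divisible by \<open>\<pi>\<close> it is a multiple of
  \<open>\<pi> ^ p\<close>, which is the gain exploited in \<open>cong_power_p\<close>.\<close>

lemma cong_add_prime_power:
  assumes "prime q" "x \<in> R" "y \<in> R"
  shows "dv (of_nat q * x) ((x + y) ^ q - (x ^ q + y ^ q))"
proof -
  obtain s where s: "s \<in> R"
    "(x + y) ^ q = x ^ q + y ^ q + of_nat q * x * y ^ (q - 1) + of_nat q * x\<^sup>2 * s"
    using prime_binomial[OF assms] by blast
  have "(x + y) ^ q - (x ^ q + y ^ q) = of_nat q * x * (y ^ (q - 1) + x * s)"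
    by (simp add: s(2) algebra_simps power2_eq_square)
  then show ?thesis using assms s(1) by auto
qed

lemma cong_sum_prime_power:
  assumes "prime q" "\<And>i. i \<in> A \<Longrightarrow> f i \<in> R"
  shows "dv (of_nat q) (sum f A ^ q - (\<Sum>i\<in>A. f i ^ q))"
  using assms(2)
proof (induction A rule: infinite_finite_induct)
  case (insert i A)
  have fi: "f i \<in> R" "sum f A \<in> R" using insert.prems by (auto intro: sum_mem)
  have "dv (of_nat q) (of_nat q * f i)" using fi by auto
  then have "dv (of_nat q) ((f i + sum f A) ^ q - (f i ^ q + sum f A ^ q))"
    using cong_add_prime_power[OF assms(1) fi] dv_trans by blast
  moreover have "dv (of_nat q) ((f i ^ q + sum f A ^ q) - (f i ^ q + (\<Sum>i\<in>A. f i ^ q)))"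
    using insert by simp
  ultimately show ?case using insert.hyps by (auto intro: dvc_trans)
qed (use assms(1) in \<open>auto simp: prime_gt_0_nat power_0_left\<close>)

lemma of_int_dv: "n dvd k \<Longrightarrow> dv (of_int n) (of_int k)"
  by (elim dvdE) (simp add: dv_I)

lemma cong_int_prime_power:
  assumes "prime q"
  shows "dv (of_nat q) (of_int a ^ q - of_int a)"
proof -
  have "int q dvd a ^ q - a"
  proof (cases "int q dvd a")
    case True
    then have "int q dvd a ^ q"
      using assms by (metis dvd_power dvd_trans prime_gt_0_nat)
    with True show ?thesis by (rule dvd_diff[rotated])
  next
    case False
    define b where "b = nat (a mod int q)"
    have q: "q > 0" using assms prime_gt_0_nat by auto
    have b: "int b = a mod int q" using q by (simp add: b_def)
    have "\<not> q dvd b"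
      using False b by (metis dvd_mod_iff int_dvd_int_iff dvd_refl)
    then have "[b ^ (q - 1) = 1] (mod q)" using assms by (rule fermat_theorem[rotated])
    then have "[b * b ^ (q - 1) = b * 1] (mod q)" by (rule cong_scalar_left)
    then have "[b ^ q = b] (mod q)" using q by (simp add: power_eq_if)
    then have "[int b ^ q = int b] (mod int q)" by (simp add: cong_int_iff flip: of_nat_power)
    moreover have "[a ^ q = int b ^ q] (mod int q)"
      by (rule cong_pow) (simp add: b cong_def)
    moreover have "[int b = a] (mod int q)" by (simp add: b cong_def)
    ultimately have "[a ^ q = a] (mod int q)" using cong_trans by blast
    then show ?thesis by (simp add: cong_iff_dvd_diff)
  qed
  from of_int_dv[OF this] show ?thesis by simp
qed

end

lemma int_adjoin_ring_set: "ring_set (int_adjoin x)"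
proof
  have dif: "map_poly of_int (f - g) = map_poly of_int f - (map_poly of_int g :: complex poly)" for f g
    by (intro poly_eqI) (simp add: coeff_map_poly)
  have mul: "map_poly of_int (f * g) = map_poly of_int f * (map_poly of_int g :: complex poly)" for f g
    by (intro poly_eqI) (simp add: coeff_map_poly coeff_mult)
  show "1 \<in> int_adjoin x"
    unfolding int_adjoin_def by (auto intro!: exI[of _ 1])
  show "a - b \<in> int_adjoin x" if "a \<in> int_adjoin x" "b \<in> int_adjoin x" for a b
  proof -
    from that obtain f g :: "int poly" where
      "a = poly (map_poly of_int f) x" "b = poly (map_poly of_int g) x"
      unfolding int_adjoin_def by blast
    then have "a - b = poly (map_poly of_int (f - g)) x" by (simp add: dif)
    then show ?thesis unfolding int_adjoin_def by blast
  qed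
  show "a * b \<in> int_adjoin x" if "a \<in> int_adjoin x" "b \<in> int_adjoin x" for a b
  proof -
    from that obtain f g :: "int poly" where
      "a = poly (map_poly of_int f) x" "b = poly (map_poly of_int g) x"
      unfolding int_adjoin_def by blast
    then have "a * b = poly (map_poly of_int (f * g)) x" by (simp add: mul)
    then show ?thesis unfolding int_adjoin_def by blast
  qed
qed

lemma int_adjoin_gen: "x \<in> int_adjoin x"
  unfolding int_adjoin_def by (auto intro!: exI[of _ "[:0, 1:]"] simp: map_poly_pCons)

lemma int_adjoin_E:
  assumes "y \<in> int_adjoin x"
  obtains n a where "y = (\<Sum>i<n. of_int (a i) * x ^ i)"
proof -
  from assms obtain f :: "int poly" where "y = poly (map_poly of_int f) x"
    unfolding int_adjoin_def by blast
  then have "y = (\<Sum>i<Suc (degree f). of_int (coeff f i) * x ^ i)"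
    by (simp add: poly_altdef degree_map_poly coeff_map_poly lessThan_Suc_atMost)
  then show ?thesis by (rule that)
qed

section \<open>Cyclotomic integers and conjugation\<close>

locale cyclotomic =
  fixes p u :: nat and z :: complex and \<sigma> :: "complex \<Rightarrow> complex"
  assumes prime_p: "prime p" and odd_p: "odd p"
    and z_power_p: "z ^ p = 1" and z_neq_1: "z \<noteq> 1"
    and primroot: "residue_primroot p u"
    and galois_sigma: "galois_aut z \<sigma>" and sigma_z: "\<sigma> z = z ^ u"
begin

abbreviation Oz ("\<O>") where "\<O> \<equiv> cyc_int z"
abbreviation Kz ("\<K>") where "\<K> \<equiv> cyc_field z"
abbreviation "\<pi> \<equiv> 1 - z"

sublocale ring_set "cyc_int z"
  unfolding cyc_int_def by (rule int_adjoin_ring_set)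

declare z_neq_1 [simp]

lemma p_ge_3: "3 \<le> p"
  using prime_p odd_p prime_ge_2_nat[of p] by (cases "p = 2") auto

lemma p_gt_0 [simp]: "0 < p"
  using p_ge_3 by simp

lemma z_mem [simp, intro]: "z \<in> \<O>"
  unfolding cyc_int_def by (rule int_adjoin_gen)

lemma p_neq_0 [simp]: "p \<noteq> 0"
  using p_gt_0 by blast

lemma pi_mem [simp, intro]: "\<pi> \<in> \<O>"
  by auto

lemma pi_neq_0 [simp]: "\<pi> \<noteq> 0"
  using z_neq_1 by simp

lemma z_neq_0 [simp]: "z \<noteq> 0"
  using z_power_p p_gt_0 by (metis power_0_left less_irrefl zero_neq_one)

lemma z_power_mod: "z ^ (n mod p) = z ^ n"
proof -
  have "z ^ n = z ^ (p * (n div p) + n mod p)" by simp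
  also have "\<dots> = z ^ (n mod p)" by (simp only: power_add power_mult z_power_p) simp
  finally show ?thesis ..
qed

lemma z_power_cong: "[m = n] (mod p) \<Longrightarrow> z ^ m = z ^ n"
  by (metis cong_def z_power_mod)

lemma z_power_eq_1_iff: "z ^ n = 1 \<longleftrightarrow> p dvd n"
proof
  assume *: "z ^ n = 1"
  show "p dvd n"
  proof (rule ccontr)
    assume "\<not> p dvd n"
    then have "coprime n p" using prime_p by (metis coprime_commute prime_imp_coprime)
    then obtain k where "[n * k = Suc 0] (mod p)" using cong_solve_coprime_nat by blast
    then have "z ^ (n * k) = z ^ Suc 0" by (rule z_power_cong)
    then show False using * z_neq_1 by (simp add: power_mult)
  qed
qed (auto simp: power_mult z_power_p elim!: dvdE)

lemma norm_z [simp]: "norm z = 1"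
proof -
  have "norm z ^ p = 1" using z_power_p by (metis norm_one norm_power)
  then show ?thesis using power_eq_imp_eq_base[of "norm z" p 1] by simp
qed

lemma cnj_z: "cnj z = inverse z"
  using complex_norm_square[of z] by (simp add: field_simps)

lemma inverse_z: "inverse z = z ^ (p - 1)"
proof -
  have "z * z ^ (p - 1) = z ^ p" by (simp add: power_eq_if)
  then show ?thesis using z_power_p by (metis inverse_unique)
qed

text \<open>For \<open>k\<close> prime to \<open>p\<close>, the numbers \<open>ev a k\<close> are the conjugates of \<open>ev a 1\<close>.\<close>

definition ev :: "(nat \<Rightarrow> int) \<Rightarrow> nat \<Rightarrow> complex" where
  "ev a k = (\<Sum>i<p. of_int (a i) * z ^ (i * k))"

lemma ev_mem [simp, intro]: "ev a k \<in> \<O>"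
  unfolding ev_def by (auto intro!: sum_mem)

lemma ev_cong: "[k = l] (mod p) \<Longrightarrow> ev a k = ev a l"
  unfolding ev_def by (intro sum.cong refl arg_cong2[of _ _ _ _ "(*)"] z_power_cong cong_scalar_left)

lemma ev_diff: "ev (\<lambda>i. a i - b i) k = ev a k - ev b k"
  by (simp add: ev_def sum_subtractf algebra_simps)

lemma ev_add: "ev (\<lambda>i. a i + b i) k = ev a k + ev b k"
  by (simp add: ev_def sum.distrib algebra_simps)

lemma ev_scale: "ev (\<lambda>i. c * a i) k = of_int c * ev a k"
  by (simp add: ev_def sum_distrib_left mult_ac)

lemma ev_single: "j < p \<Longrightarrow> ev (\<lambda>i. if i = j then c else 0) k = of_int c * z ^ (j * k)"
proof -
  assume j: "j < p"
  have "ev (\<lambda>i. if i = j then c else 0) k = (\<Sum>i<p. if i = j then of_int c * z ^ (j * k) else 0)"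
    unfolding ev_def by (intro sum.cong) auto
  then show ?thesis using j by simp
qed

lemma sum_z_powers: "(\<Sum>k<p. z ^ (n * k)) = (if p dvd n then of_nat p else 0)"
proof (cases "p dvd n")
  case True
  then have "z ^ (n * k) = 1" for k by (simp add: z_power_eq_1_iff)
  then show ?thesis using True by simp
next
  case False
  then have "z ^ n \<noteq> 1" by (simp add: z_power_eq_1_iff)
  then have "(\<Sum>k<p. (z ^ n) ^ k) = ((z ^ n) ^ p - 1) / (z ^ n - 1)" by (rule geometric_sum)
  also have "(z ^ n) ^ p = 1" by (metis power_commutes power_mult mult.commute power_one z_power_p)
  finally show ?thesis using False by (simp add: power_mult)
qed

text \<open>Orthogonality of the characters of the integers modulo \<open>p\<close>;
  \<open>p - j\<close> stands for \<open>- j\<close> so that exponents stay natural.\<close>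

lemma fourier_inversion:
  assumes "j < p"
  shows "of_nat p * of_int (a j) = (\<Sum>k<p. z ^ ((p - j) * k) * ev a k)"
proof -
  have "(\<Sum>k<p. z ^ ((p - j) * k) * ev a k)
      = (\<Sum>k<p. \<Sum>i<p. of_int (a i) * z ^ ((p - j + i) * k))"
    unfolding ev_def sum_distrib_left
    by (intro sum.cong refl) (simp add: power_add algebra_simps)
  also have "\<dots> = (\<Sum>i<p. of_int (a i) * (\<Sum>k<p. z ^ ((p - j + i) * k)))"
    unfolding sum_distrib_left by (rule sum.swap)
  also have "\<dots> = (\<Sum>i<p. if i = j then of_nat p * of_int (a j) else 0)"
  proof (intro sum.cong refl)
    fix i assume "i \<in> {..<p}"
    then have i: "i < p" by simp
    \<comment> \<open>Since \<open>0 < p - j + i < 2 * p\<close>, the only multiple of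
      \<open>p\<close> in question is \<open>p\<close> itself.\<close>
    have "p dvd (p - j + i) \<longleftrightarrow> i = j"
    proof
      assume "p dvd (p - j + i)"
      then obtain q where q: "p - j + i = p * q" by blast
      then have "0 < p * q" "p * q < p * 2" using assms i by linarith+
      then have "q = 1" by simp
      then show "i = j" using q assms by simp
    qed (use assms in auto)
    then show "of_int (a i) * (\<Sum>k<p. z ^ ((p - j + i) * k))
      = (if i = j then of_nat p * of_int (a j) else 0)"
      unfolding sum_z_powers by simp
  qed
  finally show ?thesis using assms by simp
qed

lemma cyc_int_rep:
  assumes "x \<in> \<O>"
  obtains a where "x = ev a 1"
proof -
  have "\<exists>a. (\<Sum>i<n. of_int (c i) * z ^ i) = ev a 1" for n and c :: "nat \<Rightarrow> int"
  proof (induction n)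
    case 0
    then show ?case by (intro exI[of _ "\<lambda>_. 0"]) (simp add: ev_def)
  next
    case (Suc n)
    then obtain a where a: "(\<Sum>i<n. of_int (c i) * z ^ i) = ev a 1" by blast
    have "of_int (c n) * z ^ n = ev (\<lambda>i. if i = n mod p then c n else 0) 1"
      by (simp add: ev_single z_power_mod)
    with a have "(\<Sum>i<Suc n. of_int (c i) * z ^ i)
        = ev (\<lambda>i. a i + (if i = n mod p then c n else 0)) 1"
      by (simp add: ev_add)
    then show ?case by blast
  qed
  with assms that show ?thesis unfolding cyc_int_def by (metis int_adjoin_E)
qed

lemma ev_const: "ev (\<lambda>_. c) 1 = 0"
proof -
  have "\<not> p dvd 1" using p_ge_3 by simp
  then have "(\<Sum>i<p. z ^ i) = 0" using sum_z_powers[of 1] by simp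
  then show ?thesis by (simp add: ev_def flip: sum_distrib_left)
qed

text \<open>The powers of \<open>z\<close> sum to 0, so adding a constant to all coefficients does
  not change the value. The normalization is what makes the bound in \<open>coeff_bound\<close>
  possible.\<close>

lemma cyc_int_rep_normalized:
  assumes "x \<in> \<O>"
  obtains a where "x = ev a 1" "a (p - 1) = 0"
proof -
  obtain a where a: "x = ev a 1" using cyc_int_rep assms by blast
  show ?thesis
    by (rule that[of "\<lambda>i. a i - a (p - 1)"]) (simp_all add: a ev_diff ev_const[simplified])
qed

lemma cyc_int_subset: "x \<in> \<O> \<Longrightarrow> x \<in> \<K>"
proof -
  assume "x \<in> \<O>"
  then obtain f :: "int poly" where f: "x = poly (map_poly of_int f) z"
    unfolding cyc_int_def int_adjoin_def by blast
  have "map_poly of_rat (map_poly of_int f :: rat poly) = (map_poly of_int f :: complex poly)"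
    by (intro poly_eqI) (simp add: coeff_map_poly)
  then have "x = poly (map_poly of_rat (map_poly of_int f)) z / poly (map_poly of_rat (1 :: rat poly)) z"
    by (simp add: f)
  then show ?thesis unfolding cyc_field_def rat_adjoin_def by blast
qed

section \<open>Automorphisms acting on exponent vectors\<close>

context
  fixes \<tau> k
  assumes gal: "galois_aut z \<tau>" and tau_z: "\<tau> z = z ^ k"
begin

lemma aut_of_rat: "\<tau> (of_rat q) = of_rat q"
  using gal by (simp add: galois_aut_def)

lemma aut_of_int [simp]: "\<tau> (of_int n) = of_int n"
  using aut_of_rat[of "of_int n"] by simp

lemma aut_0 [simp]: "\<tau> 0 = 0" using aut_of_int[of 0] by simp
lemma aut_1 [simp]: "\<tau> 1 = 1" using aut_of_int[of 1] by simp

lemma aut_add: "x \<in> \<K> \<Longrightarrow> y \<in> \<K> \<Longrightarrow> \<tau> (x + y) = \<tau> x + \<tau> y"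
  using gal by (simp add: galois_aut_def)

lemma aut_mult: "x \<in> \<K> \<Longrightarrow> y \<in> \<K> \<Longrightarrow> \<tau> (x * y) = \<tau> x * \<tau> y"
  using gal by (simp add: galois_aut_def)

lemma aut_power_int: "x \<in> \<O> \<Longrightarrow> \<tau> (x ^ n) = \<tau> x ^ n"
  by (induction n) (auto simp: aut_mult cyc_int_subset)

lemma aut_sum: "(\<And>i. i \<in> A \<Longrightarrow> f i \<in> \<O>) \<Longrightarrow> \<tau> (sum f A) = (\<Sum>i\<in>A. \<tau> (f i))"
  by (induction A rule: infinite_finite_induct) (auto simp: aut_add cyc_int_subset sum_mem)

lemma aut_prod: "(\<And>i. i \<in> A \<Longrightarrow> f i \<in> \<O>) \<Longrightarrow> \<tau> (prod f A) = (\<Prod>i\<in>A. \<tau> (f i))"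
  by (induction A rule: infinite_finite_induct) (auto simp: aut_mult cyc_int_subset prod_mem)

lemma aut_ev: "\<tau> (ev a l) = ev a (k * l)"
proof -
  have "\<tau> (ev a l) = (\<Sum>i<p. \<tau> (of_int (a i) * z ^ (i * l)))"
    unfolding ev_def by (rule aut_sum) auto
  also have "\<dots> = ev a (k * l)"
    unfolding ev_def
    by (intro sum.cong refl)
      (simp add: aut_mult cyc_int_subset aut_power_int tau_z mult_ac flip: power_mult)
  finally show ?thesis .
qed

lemma aut_mem: "x \<in> \<O> \<Longrightarrow> \<tau> x \<in> \<O>"
  by (metis aut_ev cyc_int_rep ev_mem)

lemma aut_inj: "x \<in> \<K> \<Longrightarrow> y \<in> \<K> \<Longrightarrow> \<tau> x = \<tau> y \<Longrightarrow> x = y"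
  using gal by (auto simp: galois_aut_def bij_betw_def inj_on_def)

lemma aut_eq_0_iff: "x \<in> \<K> \<Longrightarrow> \<tau> x = 0 \<longleftrightarrow> x = 0"
  using aut_inj[of x 0] cyc_int_subset[OF zero_mem] by auto

lemma aut_dv: "dv a x \<Longrightarrow> a \<in> \<O> \<Longrightarrow> dv (\<tau> a) (\<tau> x)"
  by (auto simp: dv_def aut_mult cyc_int_subset intro!: bexI[OF _ aut_mem])

end

lemma primroot_power:
  assumes "0 < k" "k < p"
  obtains j where "[u ^ j = k] (mod p)"
proof -
  have "p > 1" using p_ge_3 by simp
  have "totatives p = {1..<p}"
    using prime_p by (auto simp: totatives_prime)
  then have "bij_betw (\<lambda>i. u ^ i mod p) {..<totient p} {1..<p}"
    using residue_primroot_is_generator[OF \<open>p > 1\<close> primroot] by simp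
  then have "k \<in> (\<lambda>i. u ^ i mod p) ` {..<totient p}"
    using assms by (simp add: bij_betw_def)
  then show ?thesis using that assms by (auto simp: cong_def)
qed

lemma coprime_p_u: "coprime p u"
  using primroot by (auto simp: residue_primroot_def coprime_commute)

lemma ord_u: "ord p u = p - 1"
  using primroot prime_p by (simp add: residue_primroot_def totient_prime)

lemma sigma_iterate: "(\<sigma> ^^ j) (ev a 1) = ev a (u ^ j)"
  by (induction j) (simp_all add: aut_ev[OF galois_sigma sigma_z])

text \<open>\<open>\<sigma>\<close> depends on the value \<open>ev a 1\<close> and not on the vector
  \<open>a\<close>, and its iterates reach every conjugate because \<open>u\<close> is a primitive
  root. This takes the place of the irreducibility of the cyclotomic polynomial.\<close>

lemma ev_conjugate_eq:
  assumes "ev a 1 = ev b 1" "\<not> p dvd k"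
  shows "ev a k = ev b k"
proof -
  have k: "[k = k mod p] (mod p)" by (simp add: cong_def)
  have "0 < k mod p" "k mod p < p" using assms(2) by (auto simp: dvd_eq_mod_eq_0)
  then obtain j where "[u ^ j = k mod p] (mod p)" using primroot_power by blast
  then have j: "[u ^ j = k] (mod p)" by (simp add: cong_def)
  have "ev a (u ^ j) = ev b (u ^ j)" using sigma_iterate assms(1) by metis
  then show ?thesis using ev_cong[OF j] by metis
qed

lemma sum_lessThan_p: "(\<Sum>k<p. f k) = f 0 + (\<Sum>k\<in>{1..<p}. f k)" for f :: "nat \<Rightarrow> complex"
proof -
  have "{..<p} = insert 0 {1..<p}" using p_gt_0 by auto
  then show ?thesis by simp
qed

text \<open>The frequency \<open>k = 0\<close> is the only one that is not a conjugate; its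
  contribution is an integer independent of \<open>j\<close>, so it cancels when two indices are
  compared.\<close>

lemma fourier_inversion':
  assumes "j < p"
  shows "of_nat p * of_int (a j)
    = of_int (\<Sum>i<p. a i) + (\<Sum>k\<in>{1..<p}. z ^ ((p - j) * k) * ev a k)"
proof -
  have "ev a 0 = of_int (\<Sum>i<p. a i)" by (simp add: ev_def)
  then show ?thesis unfolding fourier_inversion[OF assms] sum_lessThan_p by simp
qed

lemma ev_eq_0:
  assumes "ev a 1 = 0" "i < p" "j < p"
  shows "a i = a j"
proof -
  have zero: "ev a k = 0" if "k \<in> {1..<p}" for k
    using ev_conjugate_eq[of a "\<lambda>_. 0" k] assms(1) that
    by (auto simp: ev_def nat_dvd_not_less)
  have "of_nat p * complex_of_int (a i) = of_nat p * of_int (a j)"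
    using zero by (simp add: fourier_inversion' assms)
  then show ?thesis by simp
qed

text \<open>The vector \<open>b\<close> represents 0, so \<open>ev_eq_0\<close> makes its entries
  equal; entries 0 and 1 together exhibit \<open>m\<close> as a multiple of
  \<open>n\<close>.\<close>

lemma cyc_int_rational:
  assumes "x \<in> \<O>" "of_int n * x = of_int m" "n \<noteq> 0"
  shows "\<exists>k. x = of_int k"
proof -
  obtain a where a: "x = ev a 1" using assms(1) cyc_int_rep by blast
  define b where "b i = n * a i - (if i = 0 then m else 0)" for i
  have "ev b 1 = of_int n * ev a 1 - of_int m"
    unfolding b_def ev_diff ev_scale by (simp add: ev_single)
  then have "ev b 1 = 0" using assms(2) a by simp
  then have "b 0 = b 1" using p_ge_3 by (intro ev_eq_0) auto
  then have "m = n * (a 0 - a 1)" by (simp add: b_def algebra_simps)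
  then have "of_int n * x = of_int n * of_int (a 0 - a 1)" using assms(2) by simp
  then show ?thesis using assms(3) by (metis mult_cancel_left of_int_eq_0_iff)
qed

text \<open>All conjugates of a fixed element coincide with it, so the inversion formula at index 0
  contains \<open>x\<close> exactly \<open>p - 1\<close> times and otherwise only integers.\<close>

lemma fixed_imp_rational:
  assumes "x \<in> \<O>" "\<sigma> x = x"
  shows "\<exists>n. of_nat (p - 1) * x = of_int n"
proof -
  obtain a where a: "x = ev a 1" using assms(1) cyc_int_rep by blast
  have "(\<sigma> ^^ j) x = x" for j by (induction j) (simp_all add: assms(2))
  then have *: "ev a (u ^ j) = x" for j using sigma_iterate a by metis
  have "ev a k = x" if "k \<in> {1..<p}" for k
  proof -
    from that obtain j where "[u ^ j = k] (mod p)" using primroot_power[of k] by auto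
    then show ?thesis using * ev_cong by metis
  qed
  moreover have "z ^ (p * k) = 1" for k by (simp add: z_power_eq_1_iff)
  ultimately have "of_nat p * of_int (a 0) = of_int (\<Sum>i<p. a i) + of_nat (p - 1) * x"
    using fourier_inversion'[of 0 a] by simp
  then show ?thesis
    by (intro exI[of _ "int p * a 0 - (\<Sum>i<p. a i)"]) (simp add: algebra_simps)
qed

text \<open>The cofactor is read off the norm of \<open>y\<close>, which is fixed by \<open>\<sigma>\<close> and so rational.\<close>

lemma cyc_int_dvd_int:
  assumes "y \<in> \<O>" "y \<noteq> 0"
  obtains t n where "t \<in> \<O>" "n \<noteq> 0" "y * t = of_int n"
proof -
  note sigma_aut = galois_sigma sigma_z
  obtain a where a: "y = ev a 1" using assms(1) cyc_int_rep by blast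
  define f where "f j = (\<sigma> ^^ j) y" for j
  have f_mem: "f j \<in> \<O>" for j by (simp only: f_def a sigma_iterate ev_mem)
  have f_0: "f 0 = y" by (simp add: f_def)
  have f_nz: "f j \<noteq> 0" for j
  proof (induction j)
    case (Suc j)
    then show ?case using aut_eq_0_iff[OF sigma_aut] f_mem[of j] by (simp add: f_def cyc_int_subset)
  qed (simp add: f_def assms)
  obtain n where n: "p - 1 = Suc n" using p_ge_3 by (cases "p - 1") auto
  have "[u ^ (p - 1) = 1] (mod p)" using coprime_p_u ord_u by (metis ord)
  then have fp: "f (p - 1) = y" using ev_cong by (metis a f_def sigma_iterate)
  define N where "N = (\<Prod>j<p - 1. f j)"
  have "\<sigma> N = (\<Prod>j<p - 1. \<sigma> (f j))"
    unfolding N_def by (rule aut_prod[OF sigma_aut f_mem])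
  also have "\<dots> = (\<Prod>j<p - 1. f (Suc j))" by (simp add: f_def)
  also have "\<dots> = (\<Prod>j<n. f (Suc j)) * f (p - 1)" unfolding n by simp
  also have "\<dots> = N" unfolding N_def n by (subst prod.lessThan_Suc_shift) (simp add: fp[unfolded n] f_0)
  finally have "\<sigma> N = N" .
  moreover have "N \<in> \<O>" unfolding N_def by (intro prod_mem f_mem)
  ultimately obtain m where m: "of_nat (p - 1) * N = of_int m" using fixed_imp_rational by blast
  have "N \<noteq> 0" using f_nz by (simp add: N_def)
  then have "m \<noteq> 0" using m n by auto
  have N: "N = y * (\<Prod>j<n. f (Suc j))"
    unfolding N_def n by (subst prod.lessThan_Suc_shift) (simp add: f_0)
  show ?thesis
  proof (rule that)
    show "of_nat (p - 1) * (\<Prod>j<n. f (Suc j)) \<in> \<O>" by (auto intro!: prod_mem f_mem)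
    show "y * (of_nat (p - 1) * (\<Prod>j<n. f (Suc j))) = of_int m"
      using m unfolding N by (simp add: mult_ac)
  qed fact
qed

section \<open>Field elements as fractions with integer denominators\<close>

lemma rat_poly_value:
  "\<exists>y\<in>\<O>. \<exists>n::int. n \<noteq> 0 \<and> poly (map_poly of_rat f) z = y / of_int n"
proof -
  have "\<exists>y\<in>\<O>. \<exists>n::int. n \<noteq> 0 \<and> (\<Sum>i<m. of_rat (c i) * z ^ i) = y / of_int n" for m c
  proof (induction m)
    case 0
    then show ?case by (intro bexI[of _ 0] exI[of _ 1]) auto
  next
    case (Suc m)
    then obtain y n where y: "y \<in> \<O>" "n \<noteq> 0" "(\<Sum>i<m. of_rat (c i) * z ^ i) = y / of_int n"
      by blast
    obtain r s where rs: "c m = of_int r / of_int s" "s \<noteq> 0"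
      by (metis Rat_cases Fract_of_int_quotient less_irrefl)
    have c_m: "of_rat (c m) = complex_of_int r / of_int s"
      by (simp add: rs of_rat_divide)
    have "(\<Sum>i<Suc m. of_rat (c i) * z ^ i)
        = (y * of_int s + of_int r * z ^ m * of_int n) / of_int (n * s)"
      unfolding sum.lessThan_Suc y(3) c_m using y(2) rs(2) by (simp add: field_simps)
    moreover have "y * of_int s + of_int r * z ^ m * of_int n \<in> \<O>" using y by auto
    moreover have "n * s \<noteq> 0" using y rs by simp
    ultimately show ?case by blast
  qed
  from this[of "coeff f" "Suc (degree f)"] show ?thesis
    by (simp add: poly_altdef degree_map_poly coeff_map_poly lessThan_Suc_atMost)
qed

lemma cyc_field_iff: "x \<in> \<K> \<longleftrightarrow> (\<exists>y\<in>\<O>. \<exists>n::int. n \<noteq> 0 \<and> x = y / of_int n)"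
proof
  assume "x \<in> \<K>"
  then obtain f g where x: "x = poly (map_poly of_rat f) z / poly (map_poly of_rat g) z"
    unfolding cyc_field_def rat_adjoin_def by blast
  obtain y n where y: "y \<in> \<O>" "n \<noteq> 0" "poly (map_poly of_rat f) z = y / of_int n"
    using rat_poly_value by blast
  obtain y' n' where y': "y' \<in> \<O>" "n' \<noteq> 0" "poly (map_poly of_rat g) z = y' / of_int n'"
    using rat_poly_value by blast
  show "\<exists>y\<in>\<O>. \<exists>n::int. n \<noteq> 0 \<and> x = y / of_int n"
  proof (cases "y' = 0")
    \<comment> \<open>A zero denominator gives the value 0 by the convention on division.\<close>
    case True
    then show ?thesis using x y' by (intro bexI[of _ 0] exI[of _ 1]) auto
  next
    case False
    then obtain t m where t: "t \<in> \<O>" "m \<noteq> 0" "y' * t = of_int m"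
      using cyc_int_dvd_int y' by metis
    then have "t \<noteq> 0" by auto
    have "x = (y * of_int n' * t) / (of_int n * (y' * t))"
      using x y y' False \<open>t \<noteq> 0\<close> by (simp add: field_simps)
    also have "of_int n * (y' * t) = of_int (n * m)" using t by simp
    finally have "x = (y * of_int n' * t) / of_int (n * m)" .
    moreover have "y * of_int n' * t \<in> \<O>" "n * m \<noteq> 0" using y t by auto
    ultimately show ?thesis by blast
  qed
next
  assume "\<exists>y\<in>\<O>. \<exists>n::int. n \<noteq> 0 \<and> x = y / of_int n"
  then obtain y n where y: "y \<in> \<O>" "n \<noteq> 0" "x = y / of_int n" by blast
  then obtain f :: "int poly" where f: "y = poly (map_poly of_int f) z"
    unfolding cyc_int_def int_adjoin_def by blast
  have "map_poly of_rat (map_poly of_int f :: rat poly) = (map_poly of_int f :: complex poly)"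
    by (intro poly_eqI) (simp add: coeff_map_poly)
  then have "x = poly (map_poly of_rat (map_poly of_int f)) z / poly (map_poly of_rat [:of_int n:]) z"
    by (simp add: f y map_poly_pCons)
  then show "x \<in> \<K>" unfolding cyc_field_def rat_adjoin_def by blast
qed

lemma cyc_field_E:
  assumes "x \<in> \<K>"
  obtains y n where "y \<in> \<O>" "n \<noteq> 0" "x = y / of_int n"
  using assms cyc_field_iff by blast

lemma cyc_field_I: "y \<in> \<O> \<Longrightarrow> n \<noteq> 0 \<Longrightarrow> x = y / of_int n \<Longrightarrow> x \<in> \<K>"
  using cyc_field_iff by blast

sublocale K: ring_set "cyc_field z"
proof
  show "1 \<in> \<K>" by (simp add: cyc_int_subset)
  fix x y assume "x \<in> \<K>" "y \<in> \<K>"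
  then obtain a m b n where a: "a \<in> \<O>" "m \<noteq> 0" "x = a / of_int m" and b: "b \<in> \<O>" "n \<noteq> 0" "y = b / of_int n"
    using cyc_field_E by metis
  show "x - y \<in> \<K>"
    by (rule cyc_field_I[of "a * of_int n - b * of_int m" "m * n"]) (use a b in \<open>auto simp: field_simps\<close>)
  show "x * y \<in> \<K>"
    by (rule cyc_field_I[of "a * b" "m * n"]) (use a b in \<open>auto simp: field_simps\<close>)
qed

lemma cyc_field_inverse [simp, intro]: "x \<in> \<K> \<Longrightarrow> inverse x \<in> \<K>"
proof -
  assume "x \<in> \<K>"
  then obtain a m where a: "a \<in> \<O>" "m \<noteq> 0" "x = a / of_int m" by (rule cyc_field_E)
  show ?thesis
  proof (cases "a = 0")
    case False
    then obtain t n where t: "t \<in> \<O>" "n \<noteq> 0" "a * t = of_int n" using a cyc_int_dvd_int by metis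
    show ?thesis
    proof (rule cyc_field_I)
      show "inverse x = of_int m * t / of_int n"
        using a False t(2) t(3)[symmetric] by (auto simp: field_simps)
    qed (use t in auto)
  qed (use a in auto)
qed

lemma cyc_field_divide [simp, intro]: "x \<in> \<K> \<Longrightarrow> y \<in> \<K> \<Longrightarrow> x / y \<in> \<K>"
  by (simp add: divide_inverse)

lemma aut_divide:
  assumes "galois_aut z \<tau>" "\<tau> z = z ^ k" "x \<in> \<K>" "y \<in> \<K>"
  shows "\<tau> (x / y) = \<tau> x / \<tau> y"
proof (cases "y = 0")
  case False
  then have "\<tau> x = \<tau> (x / y) * \<tau> y" using aut_mult[OF assms(1,2), of "x / y" y] assms by simp
  then show ?thesis using False assms aut_eq_0_iff[OF assms(1,2)] by (simp add: field_simps)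
qed (use assms in \<open>simp add: aut_0[OF assms(1,2)]\<close>)

lemma aut_power:
  assumes "galois_aut z \<tau>" "\<tau> z = z ^ k" "x \<in> \<K>"
  shows "\<tau> (x ^ n) = \<tau> x ^ n"
  using assms(3) by (induction n) (auto simp: aut_mult[OF assms(1,2)] aut_1[OF assms(1,2)])

lemma aut_closed: "galois_aut z \<tau> \<Longrightarrow> x \<in> \<K> \<Longrightarrow> \<tau> x \<in> \<K>"
  by (auto simp: galois_aut_def bij_betw_def)

lemma cnj_mem [simp, intro]: "x \<in> \<O> \<Longrightarrow> cnj x \<in> \<O>"
proof -
  assume "x \<in> \<O>"
  then obtain a where a: "x = ev a 1" by (rule cyc_int_rep)
  have "cnj x = ev a (p - 1)"
    unfolding a ev_def by (simp add: cnj_z inverse_z mult_ac flip: power_mult)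
  then show ?thesis by simp
qed

lemma cnj_field_mem [simp, intro]: "x \<in> \<K> \<Longrightarrow> cnj x \<in> \<K>"
proof (elim cyc_field_E)
  fix y n assume "y \<in> \<O>" "n \<noteq> 0" "x = y / of_int n"
  then show "cnj x \<in> \<K>" by (intro cyc_field_I[of "cnj y" n]) auto
qed

lemma galois_cnj: "galois_aut z cnj"
  unfolding galois_aut_def
proof (intro conjI)
  show "bij_betw cnj \<K> \<K>"
    by (rule bij_betwI[of _ _ _ cnj]) auto
  have "cnj (of_rat q) = of_rat q" for q
    by (cases q) (simp add: of_rat_rat)
  then show "\<forall>q. cnj (of_rat q) = of_rat q" by blast
qed auto

lemma cnj_z_power: "cnj z = z ^ (p - 1)"
  by (simp add: cnj_z inverse_z)

section \<open>The prime above p and integral closure\<close>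

lemma dv_cancel: "c \<noteq> 0 \<Longrightarrow> dv (c * a) (c * b) \<longleftrightarrow> dv a b"
  by (simp add: dv_def mult.assoc)

text \<open>This is \<open>(1 - \<pi>) ^ p = 1\<close> divided by \<open>\<pi>\<close>.\<close>

lemma pi_power_expansion:
  obtains s where "s \<in> \<O>" "\<pi> ^ (p - 1) = of_nat p * (\<pi> * s - 1)"
proof -
  obtain s where s: "s \<in> \<O>"
    "(- \<pi> + 1) ^ p = (- \<pi>) ^ p + 1 ^ p + of_nat p * (- \<pi>) * 1 ^ (p - 1) + of_nat p * (- \<pi>)\<^sup>2 * s"
    using prime_binomial[OF prime_p, of "- \<pi>" 1] by auto
  have "1 = - (\<pi> ^ p) + 1 - of_nat p * \<pi> + of_nat p * \<pi>\<^sup>2 * s"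
    using s(2) z_power_p by (simp add: power_minus_odd[OF odd_p] del: minus_diff_eq)
  then have "\<pi> ^ p = \<pi> * (of_nat p * (\<pi> * s - 1))"
    by (simp add: algebra_simps power2_eq_square)
  moreover have "\<pi> ^ p = \<pi> * \<pi> ^ (p - 1)" by (rule power_eq_if[THEN trans]) simp
  ultimately have "\<pi> * \<pi> ^ (p - 1) = \<pi> * (of_nat p * (\<pi> * s - 1))" by metis
  then have "\<pi> ^ (p - 1) = of_nat p * (\<pi> * s - 1)" using pi_neq_0 mult_left_cancel by blast
  with s(1) show ?thesis by (rule that)
qed

lemma p_dv_pi_power: "dv (of_nat p) (\<pi> ^ (p - 1))"
  by (rule pi_power_expansion) auto

text \<open>Bootstrapping: in \<open>p = \<pi> * p * s - \<pi> ^ (p - 1)\<close>, a factor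
  \<open>\<pi> ^ j\<close> of \<open>p\<close> on the right becomes \<open>\<pi> ^ Suc j\<close> on
  the left, until the exponent \<open>p - 1\<close> is reached.\<close>

lemma pi_power_dv_p: "dv (\<pi> ^ (p - 1)) (of_nat p)"
proof -
  obtain s where s: "s \<in> \<O>" "\<pi> ^ (p - 1) = of_nat p * (\<pi> * s - 1)"
    by (rule pi_power_expansion)
  then have eq: "of_nat p = \<pi> * of_nat p * s - \<pi> ^ (p - 1)" by (simp add: algebra_simps)
  have "dv (\<pi> ^ j) (of_nat p)" if "j \<le> p - 1" for j
    using that
  proof (induction j)
    case (Suc j)
    then have "dv (\<pi> ^ Suc j) (\<pi> * of_nat p * s)" using s(1) by (auto simp: mult.assoc)
    moreover have "dv (\<pi> ^ Suc j) (\<pi> ^ (p - 1))" using Suc.prems by (intro dv_power_le) auto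
    ultimately show ?case using eq by (metis dv_diff)
  qed auto
  then show ?thesis by blast
qed

lemma pi_dv_p: "dv \<pi> (of_nat p)"
proof -
  have "dv (\<pi> ^ 1) (\<pi> ^ (p - 1))" using p_ge_3 by (intro dv_power_le) auto
  then show ?thesis using pi_power_dv_p dv_trans by (metis power_one_right)
qed

lemma pi_power_p_dv: "dv (\<pi> ^ p) (of_nat p * \<pi>)"
proof -
  have "\<pi> ^ p = \<pi> ^ (p - 1) * \<pi>" by (metis p_gt_0 power_minus_mult)
  then show ?thesis using dv_mult[OF pi_power_dv_p dv_refl] by metis
qed

text \<open>Every power of \<open>z\<close> is 1 modulo \<open>\<pi>\<close>, so the sum of the
  coefficients is a representative.\<close>

lemma cong_int_mod_pi:
  assumes "x \<in> \<O>"
  obtains n where "dv \<pi> (x - of_int n)"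
proof -
  obtain a where a: "x = ev a 1" using assms cyc_int_rep by blast
  have 1: "dv \<pi> (z - 1)" using dv_minus_commute[of \<pi> 1 z] by auto
  have "x - of_int (\<Sum>i<p. a i) = (\<Sum>i<p. of_int (a i) * (z ^ i - 1 ^ i))"
    by (simp add: a ev_def right_diff_distrib sum_subtractf)
  moreover have "dv \<pi> \<dots>"
    by (intro dv_sum dv_mult_left dvc_power 1) auto
  ultimately show ?thesis using that by metis
qed

text \<open>If \<open>p\<close> does not divide \<open>n\<close>, Bezout makes \<open>\<pi>\<close>
  divide 1; then so does \<open>p\<close>, being a divisor of \<open>\<pi> ^ (p - 1)\<close>, and
  \<open>1 / p\<close> would be a rational element of the ring outside the integers.\<close>

lemma pi_dv_int_iff: "dv \<pi> (of_int n) \<longleftrightarrow> int p dvd n"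
proof
  assume "int p dvd n"
  then show "dv \<pi> (of_int n)" using pi_dv_p of_int_dv dv_trans by (metis of_int_of_nat_eq)
next
  assume n: "dv \<pi> (of_int n)"
  show "int p dvd n"
  proof (rule ccontr)
    assume "\<not> int p dvd n"
    then have "coprime (int p) n" using prime_p by (simp add: prime_imp_coprime)
    then obtain x y where "x * int p + y * n = 1"
      by (metis bezout_int coprime_iff_gcd_eq_1)
    then have "(1::complex) = of_int x * of_nat p + of_int y * of_int n"
      by (metis of_int_1 of_int_add of_int_mult of_int_of_nat_eq)
    moreover have "dv \<pi> (of_int x * of_nat p + of_int y * of_int n)"
      using n pi_dv_p by auto
    ultimately have "dv \<pi> 1" by metis
    then have "dv (\<pi> ^ (p - 1)) 1" using dv_power by (metis power_one)
    then have "dv (of_nat p) 1" using p_dv_pi_power dv_trans by blast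
    then obtain t where t: "t \<in> \<O>" "of_nat p * t = 1" by (auto simp: dv_def)
    then obtain k where "t = of_int k" using cyc_int_rational[of t "int p" 1] by auto
    with t have "complex_of_int (int p * k) = of_int 1" by simp
    then have "int p * k = 1" by (simp only: of_int_eq_iff)
    then have "int p dvd 1" by (metis dvd_triv_left)
    then show False using p_ge_3 by simp
  qed
qed

lemma pi_not_dv_1: "\<not> dv \<pi> 1"
  using pi_dv_int_iff[of 1] p_ge_3 by auto

lemma pi_prime:
  assumes "x \<in> \<O>" "y \<in> \<O>"
  shows "dv \<pi> (x * y) \<longleftrightarrow> dv \<pi> x \<or> dv \<pi> y"
proof
  assume *: "dv \<pi> (x * y)"
  obtain m where m: "dv \<pi> (x - of_int m)" using assms(1) by (rule cong_int_mod_pi)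
  obtain n where n: "dv \<pi> (y - of_int n)" using assms(2) by (rule cong_int_mod_pi)
  have "dv \<pi> (x * y - of_int m * of_int n)" using m n assms by (intro dvc_mult) auto
  then have "dv \<pi> (of_int (m * n))" using * cong_dv_iff by (metis of_int_mult)
  then have "int p dvd m * n" by (simp add: pi_dv_int_iff del: of_int_mult)
  then have "int p dvd m \<or> int p dvd n" using prime_p by (simp add: prime_dvd_mult_iff)
  then show "dv \<pi> x \<or> dv \<pi> y" using m n by (simp add: cong_dv_iff pi_dv_int_iff)
qed (use assms in auto)

lemma pi_prime_power: "x \<in> \<O> \<Longrightarrow> dv \<pi> (x ^ n) \<Longrightarrow> dv \<pi> x"
  by (induction n) (auto simp: pi_not_dv_1 pi_prime)

lemma pi_power_dv_cancel:
  assumes "d \<in> \<O>" "\<not> dv \<pi> d" "x \<in> \<O>" "dv (\<pi> ^ k) (d * x)"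
  shows "dv (\<pi> ^ k) x"
  using assms(3,4)
proof (induction k arbitrary: x)
  case (Suc k)
  have "dv \<pi> (\<pi> ^ Suc k)" by auto
  then have "dv \<pi> (d * x)" using Suc.prems dv_trans by blast
  then have "dv \<pi> x" using assms Suc.prems by (simp add: pi_prime)
  then obtain t where t: "t \<in> \<O>" "x = \<pi> * t" by (rule dv_E)
  have "dv (\<pi> * \<pi> ^ k) (\<pi> * (d * t))" using Suc.prems by (simp add: t mult_ac)
  then have "dv (\<pi> ^ k) (d * t)" by (simp only: dv_cancel[OF pi_neq_0])
  then have "dv (\<pi> ^ k) t" using Suc.IH t by blast
  then show ?case unfolding t by (simp only: power_Suc dv_cancel[OF pi_neq_0])
qed auto

text \<open>A nonzero integer multiple \<open>n\<close> of \<open>x\<close> would be divisible by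
  every power of \<open>p\<close>; the exponent \<open>j\<close> equal to the absolute value of
  \<open>n\<close> is already too large, as \<open>j < p ^ j\<close>.\<close>

lemma not_all_pi_powers_dv:
  assumes "x \<in> \<O>" "x \<noteq> 0"
  shows "\<exists>k. \<not> dv (\<pi> ^ k) x"
proof (rule ccontr)
  assume "\<not> (\<exists>k. \<not> dv (\<pi> ^ k) x)"
  then have all: "dv (\<pi> ^ k) x" for k by blast
  obtain t n where t: "t \<in> \<O>" "n \<noteq> 0" "x * t = of_int n" using assms by (rule cyc_int_dvd_int)
  define j where "j = nat \<bar>n\<bar>"
  have "dv (of_nat p ^ j) ((\<pi> ^ (p - 1)) ^ j)" by (intro dv_power p_dv_pi_power)
  also have "(\<pi> ^ (p - 1)) ^ j = \<pi> ^ ((p - 1) * j)" by (simp add: power_mult)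
  finally have "dv (of_nat p ^ j) x" using all dv_trans by blast
  then have "dv (of_nat p ^ j) (of_int n)" using t by (metis dv_mult_right)
  then obtain s where s: "s \<in> \<O>" "of_int n = of_nat p ^ j * s" by (rule dv_E)
  then obtain k where k: "s = of_int k"
    using cyc_int_rational[of s "int p ^ j" n] by auto
  with s have "complex_of_int n = of_int (int p ^ j * k)" by simp
  then have "int p ^ j dvd n" by (simp only: of_int_eq_iff) simp
  then have "int p ^ j \<le> \<bar>n\<bar>" 
    using dvd_imp_le_int[OF t(2)] abs_ge_self order_trans by blast
  moreover have "int j < int p ^ j"
  proof -
    have "j < p ^ j" using p_ge_3 by (intro power_gt_expt) simp
    then show ?thesis by (metis of_nat_less_iff of_nat_power)
  qed
  ultimately show False by (simp add: j_def)
qed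

lemma pi_factor:
  assumes "x \<in> \<O>" "x \<noteq> 0"
  obtains k y where "y \<in> \<O>" "\<not> dv \<pi> y" "x = \<pi> ^ k * y"
proof -
  define n where "n = (LEAST k. \<not> dv (\<pi> ^ k) x)"
  have n: "\<not> dv (\<pi> ^ n) x"
    unfolding n_def using not_all_pi_powers_dv[OF assms] by (rule LeastI_ex)
  then obtain k where k: "n = Suc k" using assms by (cases n) auto
  then have "dv (\<pi> ^ k) x" using not_less_Least[of k "\<lambda>k. \<not> dv (\<pi> ^ k) x"] n_def by auto
  then obtain y where y: "y \<in> \<O>" "x = \<pi> ^ k * y" by (rule dv_E)
  have "\<not> dv \<pi> y"
  proof
    assume "dv \<pi> y"
    then have "dv (\<pi> ^ k * \<pi>) (\<pi> ^ k * y)" by auto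
    then show False using n y k by (simp add: mult.commute)
  qed
  with y show ?thesis using that by blast
qed

lemma pi_factor_unique:
  assumes "a \<in> \<O>" "b \<in> \<O>" "\<not> dv \<pi> a" "\<not> dv \<pi> b" "\<pi> ^ i * a = \<pi> ^ j * b"
  shows "i = j"
proof -
  have *: "\<not> i < j" if "a \<in> \<O>" "b \<in> \<O>" "\<not> dv \<pi> a" "\<pi> ^ i * a = \<pi> ^ j * b" for a b i j
  proof
    assume "i < j"
    then have "\<pi> ^ j = \<pi> ^ i * \<pi> ^ (j - i)" by (simp flip: power_add)
    then have "a = \<pi> ^ (j - i) * b" using that(4) by (simp add: mult.assoc)
    moreover have "\<pi> ^ (j - i) = \<pi> * \<pi> ^ (j - i - 1)" using \<open>i < j\<close> by (simp add: power_eq_if)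
    ultimately have "a = \<pi> * (\<pi> ^ (j - i - 1) * b)" by (simp add: mult.assoc)
    then show False using that by auto
  qed
  show ?thesis using *[of a b i j] *[of b a j i] assms by auto
qed

text \<open>In the expansion of \<open>(\<pi> * t + y) ^ p\<close> the mixed terms carry
  \<open>p * \<pi>\<close> and the pure term carries \<open>\<pi> ^ p\<close>; both are divisible by
  \<open>\<pi> ^ p\<close>.\<close>

lemma cong_power_p:
  assumes "dv \<pi> (x - y)" "y \<in> \<O>"
  shows "dv (\<pi> ^ p) (x ^ p - y ^ p)"
proof -
  obtain t where t: "t \<in> \<O>" "x - y = \<pi> * t" using assms(1) by (rule dv_E)
  have x: "x = \<pi> * t + y" using t(2) by (simp add: algebra_simps)
  have 1: "dv (of_nat p * (\<pi> * t)) (x ^ p - ((\<pi> * t) ^ p + y ^ p))"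
    unfolding x using t assms(2) by (intro cong_add_prime_power prime_p) auto
  have "dv (\<pi> ^ p) (of_nat p * (\<pi> * t))"
    using dv_mult_right[OF pi_power_p_dv t(1)] by (simp only: mult.assoc)
  then have "dv (\<pi> ^ p) (x ^ p - ((\<pi> * t) ^ p + y ^ p))"
    using 1 by (rule dv_trans)
  moreover have "dv (\<pi> ^ p) ((\<pi> * t) ^ p)" using t by (auto simp: power_mult_distrib)
  ultimately have "dv (\<pi> ^ p) (x ^ p - ((\<pi> * t) ^ p + y ^ p) + (\<pi> * t) ^ p)" by (rule dv_add)
  moreover have "x ^ p - ((\<pi> * t) ^ p + y ^ p) + (\<pi> * t) ^ p = x ^ p - y ^ p"
    by (rule diff_add_eq[THEN trans]) simp
  ultimately show ?thesis by (simp only:)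
qed

text \<open>\<open>A\<close> and \<open>B\<close> have valuation 0 at \<open>\<pi>\<close>, hence so
  has \<open>\<delta> ^ p\<close> and therefore \<open>\<delta>\<close>. This clears the denominator
  of a cofactor from the field, so that its equation can be read as a congruence in the
  ring.\<close>

lemma pi_field_unit:
  assumes "A \<in> \<O>" "B \<in> \<O>" "\<not> dv \<pi> A" "\<not> dv \<pi> B" "\<delta> \<in> \<K>" "A = B * \<delta> ^ p"
  obtains x y where "x \<in> \<O>" "y \<in> \<O>" "\<not> dv \<pi> x" "\<not> dv \<pi> y" "\<delta> = x / y"
proof -
  obtain a n where a: "a \<in> \<O>" "n \<noteq> 0" "\<delta> = a / of_int n" using assms(5) by (rule cyc_field_E)
  have "A \<noteq> 0" using assms(3) by auto
  then have "a \<noteq> 0" using a assms(6) by (auto simp: power_0_left)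
  then obtain i x where x: "x \<in> \<O>" "\<not> dv \<pi> x" "a = \<pi> ^ i * x"
    using pi_factor[OF a(1) \<open>a \<noteq> 0\<close>] by blast
  have n0: "complex_of_int n \<noteq> 0" using a(2) by simp
  obtain j y where y: "y \<in> \<O>" "\<not> dv \<pi> y" "of_int n = \<pi> ^ j * y"
    using pi_factor[OF of_int_mem n0] by blast
  have "y \<noteq> 0" "x \<noteq> 0" using x(2) y(2) by auto
  have "A * (\<pi> ^ j * y) ^ p = B * (\<pi> ^ i * x) ^ p"
    unfolding assms(6) a(3) x(3)[symmetric] y(3)[symmetric] using a(2)
    by (simp add: power_divide)
  then have e: "\<pi> ^ (j * p) * (A * y ^ p) = \<pi> ^ (i * p) * (B * x ^ p)"
    by (simp add: power_mult power_mult_distrib mult_ac)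
  have "\<not> dv \<pi> (A * y ^ p)" "\<not> dv \<pi> (B * x ^ p)"
    using assms x y pi_prime_power by (auto simp: pi_prime)
  from pi_factor_unique[OF _ _ this e] have "j * p = i * p"
    using assms(1,2) x(1) y(1) by simp
  then have "j = i" by simp
  then have "\<delta> = x / y" unfolding a(3) y(3) x(3) by simp
  with x y show ?thesis using that by blast
qed

text \<open>Modulo \<open>q\<close> the \<open>q\<close>-th power is additive and fixes the integer
  coefficients by Fermat, so it only multiplies the index \<open>k\<close> by
  \<open>q\<close>.\<close>

lemma frobenius_iterate:
  assumes "prime q"
  shows "dv (of_nat q) (ev a 1 ^ (q ^ n) - ev a (q ^ n))"
proof (induction n)
  case (Suc n)
  have "dv (of_nat q) ((ev a 1 ^ (q ^ n)) ^ q - ev a (q ^ n) ^ q)"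
    using Suc by (intro dvc_power) auto
  moreover have "dv (of_nat q) (ev a (q ^ n) ^ q - (\<Sum>i<p. (of_int (a i) * z ^ (i * q ^ n)) ^ q))"
    unfolding ev_def by (intro cong_sum_prime_power assms) auto
  moreover have "dv (of_nat q) ((\<Sum>i<p. (of_int (a i) * z ^ (i * q ^ n)) ^ q) - ev a (q ^ Suc n))"
  proof -
    have "(\<Sum>i<p. (of_int (a i) * z ^ (i * q ^ n)) ^ q) - ev a (q ^ Suc n)
      = (\<Sum>i<p. (of_int (a i) ^ q - of_int (a i)) * z ^ (i * q ^ Suc n))"
      by (simp add: ev_def power_mult_distrib left_diff_distrib sum_subtractf mult_ac
          flip: power_mult)
    moreover have "dv (of_nat q) \<dots>"
      by (intro dv_sum dv_mult_right cong_int_prime_power assms) auto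
    ultimately show ?thesis by metis
  qed
  ultimately have "dv (of_nat q) ((ev a 1 ^ (q ^ n)) ^ q - ev a (q ^ Suc n))"
    using dvc_trans by blast
  then show ?case by (simp only: power_Suc2 power_mult)
qed simp

text \<open>If a prime \<open>q\<close> occurs in the denominator, then \<open>q * t\<close> is nilpotent modulo \<open>q\<close> for a suitable \<open>t\<close>
  outside the ring. For \<open>q \<noteq> p\<close> an iterate of Frobenius is the identity modulo \<open>q\<close>, and for
  \<open>q = p\<close> one argues with \<open>\<pi>\<close> instead.\<close>

lemma almost_integral:
  assumes "x \<in> \<K>" "D \<noteq> 0" "\<And>n. of_int D * x ^ n \<in> \<O>"
  shows "x \<in> \<O>"
proof -
  define P where "P d \<longleftrightarrow> d > 0 \<and> of_nat d * x \<in> \<O>" for d :: nat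
  have "\<exists>d. P d"
  proof -
    obtain y n where y: "y \<in> \<O>" "n \<noteq> 0" "x = y / of_int n" using assms(1) by (rule cyc_field_E)
    have "of_nat (nat \<bar>n\<bar>) * x = of_int \<bar>n\<bar> * x" using of_nat_nat[of "\<bar>n\<bar>"]
      by (metis abs_ge_zero of_int_of_nat_eq)
    also have "\<dots> = of_int (sgn n) * y" using y by (simp add: abs_sgn field_simps)
    finally show ?thesis using y unfolding P_def by (intro exI[of _ "nat \<bar>n\<bar>"]) auto
  qed
  \<comment> \<open>The least positive integer denominator of \<open>x\<close>; removing a prime
    \<open>q\<close> from it produces the element \<open>t\<close> outside the ring with
    \<open>q * t\<close> inside.\<close>
  define d where "d = (LEAST d. P d)"
  have d: "P d" unfolding d_def using \<open>\<exists>d. P d\<close> by (rule LeastI_ex)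
  have "d = 1"
  proof (rule ccontr)
    assume "d \<noteq> 1"
    then obtain q where q: "prime q" "q dvd d" using prime_factor_nat by blast
    then obtain e where e: "d = q * e" by blast
    have "q > 1" using q prime_gt_1_nat by blast
    have "e < d" "e > 0" using d e \<open>q > 1\<close> by (auto simp: P_def)
    define t where "t = of_nat e * x"
    have "\<not> P e" using \<open>e < d\<close> not_less_Least unfolding d_def by blast
    then have t: "t \<notin> \<O>" using \<open>e > 0\<close> by (simp add: P_def t_def)
    have qt: "of_nat q * t \<in> \<O>" using d e by (simp add: P_def t_def mult.assoc)
    have Dt: "of_int D * t ^ n \<in> \<O>" for n
    proof -
      have "of_int D * t ^ n = of_nat (e ^ n) * (of_int D * x ^ n)"
        by (simp add: t_def power_mult_distrib)
      then show ?thesis using assms(3) by (metis mult_mem of_nat_mem)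
    qed
    show False
    proof (cases "q = p")
      case True
      define Q where "Q j \<longleftrightarrow> \<pi> ^ j * t \<in> \<O>" for j
      have "Q (p - 1)"
      proof -
        obtain s where s: "s \<in> \<O>" "\<pi> ^ (p - 1) = of_nat p * s"
          using p_dv_pi_power by (rule dv_E)
        then have "\<pi> ^ (p - 1) * t = s * (of_nat q * t)" using True by simp
        then show ?thesis using qt s unfolding Q_def by (metis mult_mem)
      qed
      then have Q: "Q (LEAST j. Q j)" by (rule LeastI)
      moreover have "\<not> Q 0" using t by (simp add: Q_def)
      ultimately obtain j where j: "(LEAST j. Q j) = Suc j" by (metis not0_implies_Suc)
      \<comment> \<open>\<open>s\<close> is one factor \<open>\<pi>\<close> short of the ring:
        \<open>\<pi> * s\<close> lies in it but is not divisible by \<open>\<pi>\<close>. As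
        \<open>D\<close> clears the denominators of all powers of \<open>s\<close>, every
        \<open>\<pi> ^ n\<close> then divides \<open>D\<close>.\<close>
      define s where "s = \<pi> ^ j * t"
      have s: "s \<notin> \<O>" using j not_less_Least[of j Q] by (simp add: Q_def s_def)
      have y: "\<pi> * s \<in> \<O>" using Q j by (simp add: Q_def s_def mult.assoc)
      have "\<not> dv \<pi> (\<pi> * s)" using s by (auto simp: dv_def)
      then have ny: "\<not> dv \<pi> ((\<pi> * s) ^ n)" for n using pi_prime_power y by blast
      have "dv (\<pi> ^ n) (of_int D)" for n
      proof -
        have "of_int D * s ^ n = (\<pi> ^ j) ^ n * (of_int D * t ^ n)"
          by (simp add: s_def power_mult_distrib)
        then have "of_int D * s ^ n \<in> \<O>" using Dt by (metis mult_mem power_mem pi_mem)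
        then have "dv (\<pi> ^ n) (\<pi> ^ n * (of_int D * s ^ n))" by (rule dv_I)
        also have "\<pi> ^ n * (of_int D * s ^ n) = (\<pi> * s) ^ n * of_int D"
          by (simp add: power_mult_distrib mult_ac)
        finally show ?thesis by (rule pi_power_dv_cancel[OF power_mem[OF y] ny of_int_mem])
      qed
      then show False using not_all_pi_powers_dv[of "of_int D"] assms(2) by auto
    next
      case False
      define y where "y = of_nat q * t"
      obtain a where a: "y = ev a 1" using qt cyc_int_rep unfolding y_def by blast
      obtain c D' where c: "D = int q ^ c * D'" "\<not> int q dvd D'"
        using assms(2) q(1) multiplicity_decompose'[of D "int q"]
        by (metis \<open>q > 1\<close> not_is_unit_0 of_nat_dvd_iff of_nat_1 nat_dvd_1_iff_1 less_irrefl int_dvd_int_iff)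
      \<comment> \<open>The factor \<open>p - 1\<close> makes \<open>q ^ N\<close> congruent to 1
        modulo \<open>p\<close>, so the iterated Frobenius fixes \<open>y\<close> modulo
        \<open>q\<close>; the factor \<open>Suc c\<close> makes \<open>q ^ N\<close> exceed
        \<open>c\<close>, so a factor \<open>q\<close> is left after cancelling the part
        \<open>q ^ c\<close> of \<open>D\<close>.\<close>
      define N where "N = (p - 1) * Suc c"
      have "\<not> p dvd q" using False q(1) prime_p primes_dvd_imp_eq by blast
      then have "[q ^ (p - 1) = 1] (mod p)" by (rule fermat_theorem[OF prime_p])
      then have "[(q ^ (p - 1)) ^ Suc c = 1 ^ Suc c] (mod p)" by (rule cong_pow)
      then have "[q ^ N = 1] (mod p)" by (simp only: N_def power_mult power_one)
      then have "ev a (q ^ N) = ev a 1" by (rule ev_cong)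
      then have yM: "dv (of_nat q) (y ^ (q ^ N) - y)"
        using frobenius_iterate[OF q(1), of a N] a by simp
      have "c < 1 * Suc c" by simp
      also have "1 * Suc c \<le> N"
        unfolding N_def by (rule mult_le_mono1) (use p_ge_3 in simp)
      also have "N < q ^ N" using power_gt_expt[of q N] \<open>q > 1\<close> by simp
      finally have "c < q ^ N" .
      then have "q ^ N = c + Suc (q ^ N - c - 1)" by simp
      from arg_cong[OF this, of "(^) (of_nat q)"]
      have qM: "(of_nat q :: complex) ^ (q ^ N) = of_nat q ^ c * (of_nat q * of_nat q ^ (q ^ N - c - 1))"
        by (simp only: power_add power_Suc)
      have "(of_nat q :: complex) ^ c * (of_int D' * y ^ (q ^ N))
          = of_nat q ^ (q ^ N) * (of_int D * t ^ (q ^ N))"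
        by (simp add: c(1) y_def power_mult_distrib mult_ac)
      also have "\<dots> = of_nat q ^ c * (of_nat q * (of_nat q ^ (q ^ N - c - 1) * (of_int D * t ^ (q ^ N))))"
        unfolding qM by (simp only: mult.assoc)
      finally have "of_int D' * y ^ (q ^ N)
          = of_nat q * (of_nat q ^ (q ^ N - c - 1) * (of_int D * t ^ (q ^ N)))"
        using \<open>q > 1\<close> by simp
      then have dv1: "dv (of_nat q) (of_int D' * y ^ (q ^ N))"
        using Dt by (metis dv_I mult_mem of_nat_mem power_mem)
      have "coprime (int q) D'" using c(2) q(1) by (simp add: prime_imp_coprime)
      then obtain r s where "r * int q + s * D' = 1"
        by (metis bezout_int coprime_iff_gcd_eq_1)
      then have "(1::complex) = of_int r * of_nat q + of_int s * of_int D'"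
        by (metis of_int_1 of_int_add of_int_mult of_int_of_nat_eq)
      then have "y ^ (q ^ N) = (of_int r * of_nat q + of_int s * of_int D') * y ^ (q ^ N)" by simp
      also have "\<dots> = of_nat q * (of_int r * y ^ (q ^ N)) + of_int s * (of_int D' * y ^ (q ^ N))"
        by (simp add: algebra_simps)
      finally have "dv (of_nat q) (y ^ (q ^ N))"
        using dv1 qt y_def by (metis dv_I dv_add dv_mult_left mult_mem of_int_mem power_mem)
      then have "dv (of_nat q) y" using yM cong_dv_iff by blast
      then show False using t \<open>q > 1\<close> by (auto simp: dv_def y_def)
    qed
  qed
  then show ?thesis using d by (simp add: P_def)
qed

text \<open>Exponents can be reduced below \<open>p\<close> at the cost of integral factors
  \<open>x ^ p\<close>, so \<open>n ^ p\<close> is a common denominator of all powers of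
  \<open>x\<close>, and \<open>almost_integral\<close> applies.\<close>

lemma integrally_closed:
  assumes "x \<in> \<K>" "x ^ p \<in> \<O>"
  shows "x \<in> \<O>"
proof -
  obtain y n where y: "y \<in> \<O>" "n \<noteq> 0" "x = y / of_int n" using assms(1) by (rule cyc_field_E)
  have "of_int (n ^ p) * x ^ k \<in> \<O>" for k
  proof -
    define r where "r = k mod p"
    have r: "r < p" by (simp add: r_def)
    have "k = p * (k div p) + r" by (simp add: r_def)
    then have "x ^ k = (x ^ p) ^ (k div p) * x ^ r" by (metis power_add power_mult)
    moreover have "of_int (n ^ p) * x ^ r = of_int (n ^ (p - r)) * y ^ r"
    proof -
      have "n ^ p = n ^ (p - r) * n ^ r" using r by (simp flip: power_add)
      then show ?thesis using y by (simp add: power_divide)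
    qed
    ultimately have "of_int (n ^ p) * x ^ k = (x ^ p) ^ (k div p) * (of_int (n ^ (p - r)) * y ^ r)"
      by (simp add: mult_ac)
    then show ?thesis using assms(2) y(1) by auto
  qed
  then show ?thesis using almost_integral[OF assms(1), of "n ^ p"] y by simp
qed

section \<open>Units of absolute value one\<close>

lemma cnj_ev: "cnj (ev a k) = ev a ((p - 1) * k)"
  unfolding ev_def by (simp add: cnj_z inverse_z mult_ac flip: power_mult)

lemma aut_cnj:
  assumes "galois_aut z \<tau>" "\<tau> z = z ^ k" "x \<in> \<O>"
  shows "\<tau> (cnj x) = cnj (\<tau> x)"
proof -
  obtain a where a: "x = ev a 1" using assms(3) by (rule cyc_int_rep)
  show ?thesis unfolding a cnj_ev aut_ev[OF assms(1,2)] by (simp add: mult_ac)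
qed

text \<open>\<open>\<sigma>\<close> commutes with \<open>cnj\<close>, so the relation
  \<open>x * cnj x = 1\<close> passes to every conjugate.\<close>

lemma norm_conjugates:
  assumes "ev a 1 * cnj (ev a 1) = 1" "k \<in> {1..<p}"
  shows "norm (ev a k) = 1"
proof -
  note sigma_aut = galois_sigma sigma_z
  have *: "ev a (u ^ j) * cnj (ev a (u ^ j)) = 1" for j
  proof (induction j)
    case (Suc j)
    have "\<sigma> (ev a (u ^ j) * cnj (ev a (u ^ j))) = ev a (u ^ Suc j) * cnj (ev a (u ^ Suc j))"
      by (simp add: aut_mult[OF sigma_aut] cyc_int_subset aut_cnj[OF sigma_aut] aut_ev[OF sigma_aut])
    then show ?case using Suc aut_1[OF sigma_aut] by simp
  qed (use assms(1) in simp)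
  obtain j where "[u ^ j = k] (mod p)" using primroot_power[of k] assms(2) by auto
  then have "ev a k * cnj (ev a k) = 1" using * ev_cong by metis
  then have "(norm (ev a k))\<^sup>2 = 1" by (metis complex_norm_square of_real_eq_1_iff)
  then show ?thesis by (simp add: power2_eq_1_iff) (use norm_ge_zero[of "ev a k"] in linarith)
qed

text \<open>Subtracting the inversion formula at the index \<open>p - 1\<close>, whose coefficient
  is 0, removes the integer term of frequency 0. What remains is \<open>p - 1\<close> differences of
  numbers of absolute value 1, at most \<open>2 * p\<close> in total.\<close>

lemma coeff_bound:
  assumes "ev a 1 * cnj (ev a 1) = 1" "a (p - 1) = 0" "j < p"
  shows "\<bar>a j\<bar> \<le> 2"
proof -
  have unit: "norm (z ^ l * ev a k) = 1" if "k \<in> {1..<p}" for l k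
    using norm_conjugates[OF assms(1) that] by (simp add: norm_mult norm_power)
  have "of_nat p * complex_of_int (a j) = of_nat p * of_int (a j) - of_nat p * of_int (a (p - 1))"
    using assms(2) by simp
  also have "\<dots> = (\<Sum>k\<in>{1..<p}. z ^ ((p - j) * k) * ev a k - z ^ ((p - (p - 1)) * k) * ev a k)"
    using fourier_inversion'[OF assms(3), of a] fourier_inversion'[of "p - 1" a]
    by (simp add: sum_subtractf)
  finally have eq: "of_nat p * complex_of_int (a j) = \<dots>" .
  have "norm (\<Sum>k\<in>{1..<p}. z ^ ((p - j) * k) * ev a k - z ^ ((p - (p - 1)) * k) * ev a k)
      \<le> (\<Sum>k\<in>{1..<p}. 2)"
  proof (rule sum_norm_le)
    fix k assume k: "k \<in> {1..<p}"
    have "norm (z ^ ((p - j) * k) * ev a k - z ^ ((p - (p - 1)) * k) * ev a k)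
        \<le> norm (z ^ ((p - j) * k) * ev a k) + norm (z ^ ((p - (p - 1)) * k) * ev a k)"
      by (rule norm_triangle_ineq4)
    then show "norm (z ^ ((p - j) * k) * ev a k - z ^ ((p - (p - 1)) * k) * ev a k) \<le> 2"
      using unit[OF k] by simp
  qed
  also have "\<dots> \<le> 2 * real p" using p_ge_3 by simp
  finally have "norm (of_nat p * complex_of_int (a j)) \<le> 2 * real p" by (simp only: eq)
  then have "real p * real_of_int \<bar>a j\<bar> \<le> real p * 2" by (simp add: norm_mult)
  then have "real_of_int \<bar>a j\<bar> \<le> 2" by (rule mult_left_le_imp_le) simp
  then show ?thesis by linarith
qed

text \<open>Kronecker: all conjugates of the powers of \<open>w\<close> lie on the unit circle, so there are only
  finitely many of these powers.\<close>

lemma kronecker: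
  assumes "w \<in> \<O>" "w * cnj w = 1"
  obtains n where "n > 0" "w ^ n = 1"
proof -
  define A where "A = (\<lambda>a. ev a 1) ` (\<Pi>\<^sub>E i\<in>{..<p}. {-2..2::int})"
  have "w ^ n \<in> A" for n
  proof -
    obtain a where a: "w ^ n = ev a 1" "a (p - 1) = 0"
      using cyc_int_rep_normalized[of "w ^ n"] assms(1) by blast
    have "ev a 1 * cnj (ev a 1) = (w * cnj w) ^ n"
      unfolding a(1)[symmetric] by (simp add: power_mult_distrib)
    then have "ev a 1 * cnj (ev a 1) = 1" using assms(2) by simp
    then have "\<bar>a j\<bar> \<le> 2" if "j < p" for j using coeff_bound a(2) that by blast
    then have "restrict a {..<p} \<in> (\<Pi>\<^sub>E i\<in>{..<p}. {-2..2::int})"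
      unfolding restrict_PiE_iff by (fastforce simp: abs_le_iff)
    moreover have "ev a 1 = ev (restrict a {..<p}) 1" by (simp add: ev_def)
    ultimately show ?thesis unfolding A_def a(1) by blast
  qed
  moreover have "finite A" unfolding A_def by (intro finite_imageI finite_PiE) auto
  ultimately have "finite (range (\<lambda>n. w ^ n))" by (metis finite_subset image_subsetI)
  then have "\<not> inj (\<lambda>n. w ^ n)" using finite_imageD infinite_UNIV_nat by blast
  then obtain i j where ij: "i < j" "w ^ i = w ^ j"
    unfolding inj_def by (metis linorder_neqE_nat)
  have "w \<noteq> 0" using assms(2) by auto
  have "w ^ j = w ^ i * w ^ (j - i)" using ij(1) by (simp flip: power_add)
  then have "w ^ (j - i) = 1" using ij \<open>w \<noteq> 0\<close> by simp
  then show ?thesis using ij that[of "j - i"] by simp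
qed

text \<open>Otherwise some power \<open>1 + x\<close> of \<open>w\<close> has prime order
  \<open>q\<close>, with \<open>x\<close> divisible by \<open>\<pi> ^ 2\<close>. Expanding
  \<open>(1 + x) ^ q = 1\<close> and dividing by \<open>x\<close> shows that \<open>\<pi>\<close>
  divides \<open>q\<close> if \<open>q \<noteq> p\<close>, and that
  \<open>\<pi> ^ (2 * (p - 1))\<close> divides \<open>p\<close> if \<open>q = p\<close>; both are
  impossible. The example \<open>w = z\<close> shows that modulus \<open>\<pi>\<close> would be too
  weak.\<close>

lemma root_of_unity_cong_1:
  assumes "w \<in> \<O>" "n > 0" "w ^ n = 1" "dv (\<pi>\<^sup>2) (w - 1)"
  shows "w = 1"
proof (rule ccontr)
  assume "w \<noteq> 1"
  define N where "N = (LEAST n. n > 0 \<and> w ^ n = 1)"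
  have N: "N > 0 \<and> w ^ N = 1" unfolding N_def using assms(2,3) by (intro LeastI) auto
  with \<open>w \<noteq> 1\<close> have "N \<noteq> 1" by auto
  then obtain q where q: "prime q" "q dvd N" using prime_factor_nat by blast
  then obtain e where e: "N = q * e" by blast
  have "e > 0" "e < N" using N e q prime_gt_1_nat[of q] by auto
  then have "w ^ e \<noteq> 1" using not_less_Least[of e "\<lambda>n. n > 0 \<and> w ^ n = 1"] by (auto simp: N_def)
  define x where "x = w ^ e - 1"
  have x0: "x \<noteq> 0" using \<open>w ^ e \<noteq> 1\<close> by (simp add: x_def)
  have x: "x \<in> \<O>" using assms(1) by (auto simp: x_def)
  have x2: "dv (\<pi>\<^sup>2) x" using dvc_power[OF assms(4), of e] assms(1) by (simp add: x_def)
  have xq: "(x + 1) ^ q = 1" using N e by (simp add: x_def mult.commute flip: power_mult)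
  have "dv \<pi> (\<pi>\<^sup>2)" by (auto simp: power2_eq_square)
  then have x1: "dv \<pi> x" using x2 dv_trans by blast
  show False
  proof (cases "q = p")
    case False
    obtain s where s: "s \<in> \<O>" "(1 + x) ^ q = 1 + of_nat q * x + x\<^sup>2 * s"
      using binomial_remainder[OF x] by blast
    then have "x * (of_nat q + x * s) = 0"
      using xq by (simp add: algebra_simps power2_eq_square)
    then have "of_nat q = - (x * s)" using x0 by (simp add: add_eq_0_iff2)
    then have "dv \<pi> (of_int (int q))" using dv_mult_right[OF x1 s(1)] by simp
    then have "p dvd q" by (simp only: pi_dv_int_iff int_dvd_int_iff)
    then show False using False q(1) prime_p primes_dvd_imp_eq by blast
  next
    case True
    obtain s where s: "s \<in> \<O>"
      "(x + 1) ^ p = x ^ p + 1 ^ p + of_nat p * x * 1 ^ (p - 1) + of_nat p * x\<^sup>2 * s"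
      using prime_binomial[OF prime_p x, of 1] by auto
    have "x ^ p = x * x ^ (p - 1)" by (rule power_eq_if[THEN trans]) simp
    then have "x * (x ^ (p - 1) + of_nat p * (1 + x * s)) = 0"
      using s(2) xq True by (simp add: algebra_simps power2_eq_square)
    then have eq: "(1 + x * s) * of_nat p = - (x ^ (p - 1))"
      using x0 by (simp add: add_eq_0_iff2 mult.commute)
    have "dv ((\<pi>\<^sup>2) ^ (p - 1)) (x ^ (p - 1))" by (rule dv_power[OF x2])
    then have dv_prod: "dv (\<pi> ^ (2 * (p - 1))) ((1 + x * s) * of_nat p)"
      unfolding eq by (simp add: power_mult)
    have not_dv: "\<not> dv \<pi> (1 + x * s)"
    proof
      assume "dv \<pi> (1 + x * s)"
      then have "dv \<pi> (1 + x * s - x * s)" using x1 s by blast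
      then show False using pi_not_dv_1 by simp
    qed
    have "1 + x * s \<in> \<O>" using x s(1) by blast
    then have "dv (\<pi> ^ (2 * (p - 1))) (of_nat p)"
      using not_dv of_nat_mem dv_prod by (rule pi_power_dv_cancel)
    then have "dv (\<pi> ^ (2 * (p - 1))) (\<pi> ^ (p - 1))" using p_dv_pi_power dv_trans by blast
    moreover have "\<pi> ^ (2 * (p - 1)) = \<pi> ^ (p - 1) * \<pi> ^ (p - 1)" by (simp add: mult_2 power_add)
    ultimately have "dv (\<pi> ^ (p - 1) * \<pi> ^ (p - 1)) (\<pi> ^ (p - 1) * 1)" by (simp only: mult_1_right)
    then have "dv (\<pi> ^ (p - 1)) 1" by (subst (asm) dv_cancel) simp_all
    moreover have "dv \<pi> (\<pi> ^ (p - 1))"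
      using dv_power_le[of 1 "p - 1" \<pi>] p_ge_3 by simp
    ultimately show False using pi_not_dv_1 dv_trans by blast
  qed
qed

lemma unit_cong_int_real:
  assumes "e \<in> \<O>" "e * e' = 1" "e' \<in> \<O>" "dv (\<pi>\<^sup>2) (e - of_int c)"
  shows "cnj e = e"
proof -
  note cnj_aut = galois_cnj cnj_z_power
  \<comment> \<open>\<open>cnj e'\<close> is the inverse of \<open>cnj e\<close>, so this is
    \<open>e / cnj e\<close>, visibly in the ring. It is 1 modulo \<open>\<pi> ^ 2\<close> because
    \<open>cnj\<close> fixes the integer \<open>c\<close> and maps \<open>\<pi>\<close> to a
    multiple of \<open>\<pi>\<close>.\<close>
  define w where "w = e * cnj e'"
  have e0: "cnj e' * cnj e = 1" using assms(2) by (metis complex_cnj_mult complex_cnj_one mult.commute)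
  have w: "w \<in> \<O>" using assms by (auto simp: w_def)
  have "w * cnj w = (e * e') * (cnj e' * cnj e)" by (simp add: w_def)
  then have "w * cnj w = 1" using assms(2) e0 by simp
  then obtain n where n: "n > 0" "w ^ n = 1" using kronecker w by blast
  have "dv (cnj (\<pi>\<^sup>2)) (cnj (e - of_int c))" by (rule aut_dv[OF cnj_aut assms(4)]) auto
  moreover have "dv \<pi> (cnj \<pi>)"
  proof -
    have "z * z ^ (p - 1) = 1" by (metis inverse_z right_inverse z_neq_0)
    then have "cnj \<pi> = \<pi> * (- (z ^ (p - 1)))"
      by (simp add: cnj_z_power algebra_simps)
    then show ?thesis by (metis dv_I power_mem uminus_mem z_mem)
  qed
  then have "dv (\<pi>\<^sup>2) (cnj (\<pi>\<^sup>2))" by (simp add: dv_power del: complex_cnj_diff)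
  ultimately have "dv (\<pi>\<^sup>2) (cnj (e - of_int c))" using dv_trans by blast
  then have "dv (\<pi>\<^sup>2) (cnj e - of_int c)" by simp
  then have "dv (\<pi>\<^sup>2) ((e - of_int c) - (cnj e - of_int c))" using assms(4) by blast
  then have "dv (\<pi>\<^sup>2) ((e - cnj e) * cnj e')" using assms(3) by auto
  also have "(e - cnj e) * cnj e' = w - 1" using e0 by (simp add: w_def algebra_simps)
  finally have "w = 1" using root_of_unity_cong_1 w n by blast
  have "e = e * (cnj e' * cnj e)" using e0 by simp
  also have "\<dots> = w * cnj e" by (simp only: w_def mult.assoc)
  finally show ?thesis using \<open>w = 1\<close> by simp
qed

end

text \<open>The recurrence of Chebyshev type obtained by multiplying the previous term by
  \<open>x + inverse x\<close>.\<close>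

lemma power_plus_inverse_power_mem:
  assumes "x \<noteq> 0"
  shows "x ^ k + inverse x ^ k \<in> int_adjoin (x + inverse x)"
proof (induction k rule: less_induct)
  case (less k)
  interpret ring_set "int_adjoin (x + inverse x)" by (rule int_adjoin_ring_set)
  consider "k = 0" | "k = 1" | l where "k = Suc (Suc l)"
    by (metis One_nat_def not0_implies_Suc)
  then show ?case
  proof cases
    case 3
    have "x ^ k + inverse x ^ k
        = (x + inverse x) * (x ^ Suc l + inverse x ^ Suc l) - (x ^ l + inverse x ^ l)"
      using assms by (simp add: 3 field_simps)
    then show ?thesis using less[of "Suc l"] less[of l] 3 int_adjoin_gen[of "x + inverse x"] by auto
  qed (auto intro: int_adjoin_gen)
qed

text \<open>In the expanded product the terms for \<open>(i, j)\<close> and \<open>(j, i)\<close>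
  have the same integer coefficient and pair up to \<open>z ^ k + inverse z ^ k\<close>. This puts
  \<open>\<eta>\<close>, a power of a relative norm, into the ring generated by
  \<open>z + inverse z\<close> by its very shape.\<close>

lemma (in cyclotomic) norm_mem_real_cyc_int:
  assumes "x \<in> \<O>"
  shows "x * cnj x \<in> real_cyc_int z"
proof -
  interpret R: ring_set "int_adjoin (z + inverse z)" by (rule int_adjoin_ring_set)
  obtain n a where x: "x = (\<Sum>i<n. of_int (a i) * z ^ i)"
    using assms unfolding cyc_int_def by (rule int_adjoin_E)
  have "(\<Sum>i<n. of_int (a i) * z ^ i) * cnj (\<Sum>i<n. of_int (a i) * z ^ i) \<in> int_adjoin (z + inverse z)" for n
  proof (induction n)
    case (Suc n)
    define S where "S = (\<Sum>i<n. of_int (a i) * z ^ i)"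
    have zz: "z ^ n * inverse z ^ n = 1" by (simp flip: power_mult_distrib)
    have mid: "z ^ i * inverse z ^ n + inverse z ^ i * z ^ n = z ^ (n - i) + inverse z ^ (n - i)"
      if "i < n" for i
    proof -
      have split: "y ^ n = y ^ (n - i) * y ^ i" for y :: complex
        using that by (simp flip: power_add)
      have "z ^ i * inverse z ^ n + inverse z ^ i * z ^ n
          = (z ^ i * inverse z ^ i) * (z ^ (n - i) + inverse z ^ (n - i))"
        unfolding split[of z] split[of "inverse z"] by (simp only: algebra_simps)
      also have "z ^ i * inverse z ^ i = 1" by (simp flip: power_mult_distrib)
      finally show ?thesis by simp
    qed
    have "S * inverse z ^ n + cnj S * z ^ n
        = (\<Sum>i<n. of_int (a i) * (z ^ i * inverse z ^ n + inverse z ^ i * z ^ n))"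
      by (simp add: S_def sum_distrib_left cnj_z algebra_simps sum.distrib)
    also have "\<dots> = (\<Sum>i<n. of_int (a i) * (z ^ (n - i) + inverse z ^ (n - i)))"
      by (intro sum.cong refl arg_cong2[of _ _ _ _ "(*)"] mid) simp
    finally have T: "S * inverse z ^ n + cnj S * z ^ n \<in> int_adjoin (z + inverse z)"
      by (simp only:) (intro R.sum_mem R.mult_mem R.of_int_mem power_plus_inverse_power_mem z_neq_0)
    have "(\<Sum>i<Suc n. of_int (a i) * z ^ i) * cnj (\<Sum>i<Suc n. of_int (a i) * z ^ i)
        = S * cnj S + of_int (a n) * (S * inverse z ^ n + cnj S * z ^ n) + of_int (a n) * of_int (a n) * (z ^ n * inverse z ^ n)"
      by (simp add: S_def[symmetric] cnj_z algebra_simps)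
    also have "\<dots> \<in> int_adjoin (z + inverse z)"
      unfolding zz by (intro R.add_mem R.mult_mem R.of_int_mem R.one_mem T Suc[folded S_def])
    finally show ?case .
  qed auto
  then show ?thesis unfolding x real_cyc_int_def .
qed

section \<open>Fractional ideals and the class group\<close>

lemma ideal_mult_0 [simp, intro]: "0 \<in> ideal_mult I J"
  unfolding ideal_mult_def by (auto intro!: exI[of _ 0])

lemma ideal_mult_add_product:
  assumes "x \<in> ideal_mult I J" "a \<in> I" "b \<in> J"
  shows "x + a * b \<in> ideal_mult I J"
proof -
  obtain n :: nat and c d where n: "x = (\<Sum>i<n. c i * d i)" "\<forall>i<n. c i \<in> I \<and> d i \<in> J"
    using assms(1) unfolding ideal_mult_def by blast
  define c' d' where "c' = c(n := a)" and "d' = d(n := b)"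
  have "x + a * b = (\<Sum>i<Suc n. c' i * d' i)"
    unfolding n(1) c'_def d'_def by simp
  moreover have "\<forall>i<Suc n. c' i \<in> I \<and> d' i \<in> J"
    using n(2) assms(2,3) by (auto simp: c'_def d'_def less_Suc_eq)
  ultimately show ?thesis unfolding ideal_mult_def by blast
qed

lemma ideal_mult_product: "a \<in> I \<Longrightarrow> b \<in> J \<Longrightarrow> a * b \<in> ideal_mult I J"
  using ideal_mult_add_product[OF ideal_mult_0] by fastforce

lemma ideal_mult_induct [consumes 1, case_names zero add]:
  assumes "x \<in> ideal_mult I J" "P 0"
    and "\<And>x a b. P x \<Longrightarrow> x \<in> ideal_mult I J \<Longrightarrow> a \<in> I \<Longrightarrow> b \<in> J \<Longrightarrow> P (x + a * b)"
  shows "P x"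
proof -
  obtain n :: nat and c d where n: "x = (\<Sum>i<n. c i * d i)" "\<forall>i<n. c i \<in> I \<and> d i \<in> J"
    using assms(1) unfolding ideal_mult_def by blast
  have "P (\<Sum>i<m. c i * d i) \<and> (\<Sum>i<m. c i * d i) \<in> ideal_mult I J" if "m \<le> n" for m
    using that
  proof (induction m)
    case (Suc m)
    then have "c m \<in> I" "d m \<in> J" using n(2) by auto
    then show ?case using Suc assms(3) by (simp add: ideal_mult_add_product)
  qed (use assms(2) in auto)
  then show ?thesis using n(1) by blast
qed

lemma ideal_mult_add:
  assumes "x \<in> ideal_mult I J" "y \<in> ideal_mult I J"
  shows "x + y \<in> ideal_mult I J"
  using assms(2)
proof (induction rule: ideal_mult_induct)
  case (add y a b)
  then have "(x + y) + a * b \<in> ideal_mult I J" by (intro ideal_mult_add_product)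
  then show ?case by (simp add: add.assoc)
qed (use assms(1) in simp)

lemma ideal_mult_mono: "I \<subseteq> I' \<Longrightarrow> J \<subseteq> J' \<Longrightarrow> ideal_mult I J \<subseteq> ideal_mult I' J'"
  unfolding ideal_mult_def by blast

lemma ideal_mult_commute: "ideal_mult I J = ideal_mult J I"
proof -
  have "ideal_mult I J \<subseteq> ideal_mult J I" for I J
  proof
    fix x assume "x \<in> ideal_mult I J"
    then show "x \<in> ideal_mult J I"
    proof (induction rule: ideal_mult_induct)
      case (add x a b)
      then show ?case using ideal_mult_add_product[of x J I b a] by (simp add: mult.commute)
    qed simp
  qed
  then show ?thesis by blast
qed

lemma ideal_mult_assoc_subset:
  "ideal_mult (ideal_mult I J) L \<subseteq> ideal_mult I (ideal_mult J L)"
proof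
  have *: "x * c \<in> ideal_mult I (ideal_mult J L)" if "x \<in> ideal_mult I J" "c \<in> L" for x c
    using that(1)
  proof (induction rule: ideal_mult_induct)
    case (add x a b)
    then have "x * c + a * (b * c) \<in> ideal_mult I (ideal_mult J L)"
      using ideal_mult_add_product[OF _ _ ideal_mult_product] that(2) by blast
    then show ?case by (simp add: algebra_simps)
  qed simp
  fix x assume "x \<in> ideal_mult (ideal_mult I J) L"
  then show "x \<in> ideal_mult I (ideal_mult J L)"
    by (induction rule: ideal_mult_induct) (auto intro: ideal_mult_add *)
qed

lemma ideal_mult_assoc: "ideal_mult (ideal_mult I J) L = ideal_mult I (ideal_mult J L)"
  using ideal_mult_assoc_subset[of I J L] ideal_mult_assoc_subset[of L J I]
  by (simp add: ideal_mult_commute subset_antisym)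

context cyclotomic
begin

abbreviation IG where "IG \<equiv> ideal_group z"
abbreviation CG where "CG \<equiv> class_group z"
abbreviation fideal where "fideal \<equiv> fractional_ideal z"
abbreviation cls where "cls \<equiv> ideal_class z"

lemma fracD:
  assumes "fideal I"
  shows "x \<in> I \<Longrightarrow> x \<in> \<K>" "0 \<in> I"
    "x \<in> I \<Longrightarrow> y \<in> I \<Longrightarrow> x + y \<in> I" "r \<in> \<O> \<Longrightarrow> x \<in> I \<Longrightarrow> r * x \<in> I"
  using assms unfolding fractional_ideal_def by blast+

lemma frac_nonzero: "fideal I \<Longrightarrow> \<exists>x\<in>I. x \<noteq> 0"
  unfolding fractional_ideal_def by blast

lemma ideal_mult_mem_ring:
  assumes "ring_set R" "x \<in> ideal_mult I J" "I \<subseteq> R" "J \<subseteq> R"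
  shows "x \<in> R"
proof -
  interpret R: ring_set R by fact
  show ?thesis using assms(2) by (induction rule: ideal_mult_induct) (use assms in auto)
qed

lemma frac_mult:
  assumes I: "fideal I" and J: "fideal J"
  shows "fideal (ideal_mult I J)"
proof -
  have sub: "x \<in> \<K>" if "x \<in> ideal_mult I J" for x
    using K.ring_set_axioms that by (rule ideal_mult_mem_ring) (use fracD I J in auto)
  obtain a where a: "a \<in> I" "a \<noteq> 0" using frac_nonzero I by blast
  obtain b where b: "b \<in> J" "b \<noteq> 0" using frac_nonzero J by blast
  have "a * b \<noteq> 0" using a b by simp
  then have nz: "ideal_mult I J \<noteq> {0}"
    using ideal_mult_product[OF a(1) b(1)] by blast
  have scale: "r * x \<in> ideal_mult I J" if "x \<in> ideal_mult I J" "r \<in> \<O>" for r x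
    using that(1)
  proof (induction rule: ideal_mult_induct)
    case (add x a b)
    then have "r * x + (r * a) * b \<in> ideal_mult I J"
      using that(2) I by (intro ideal_mult_add_product) (auto simp: fracD)
    then show ?case by (simp add: algebra_simps)
  qed simp
  obtain d where d: "d \<in> \<O>" "d \<noteq> 0" "\<forall>x\<in>I. d * x \<in> \<O>"
    using I unfolding fractional_ideal_def by blast
  obtain e where e: "e \<in> \<O>" "e \<noteq> 0" "\<forall>x\<in>J. e * x \<in> \<O>"
    using J unfolding fractional_ideal_def by blast
  have "d * e * x \<in> \<O>" if "x \<in> ideal_mult I J" for x
    using that
  proof (induction rule: ideal_mult_induct)
    case (add x a b)
    then have "d * e * x + (d * a) * (e * b) \<in> \<O>" using d e by auto
    then show ?case by (simp add: algebra_simps)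
  qed simp
  then have "\<exists>d\<in>\<O>. d \<noteq> 0 \<and> (\<forall>x\<in>ideal_mult I J. d * x \<in> \<O>)"
    using d e by (intro bexI[of _ "d * e"]) auto
  then show ?thesis
    unfolding fractional_ideal_def using sub nz scale ideal_mult_add by auto
qed

lemma frac_cyc_int: "fideal \<O>"
  unfolding fractional_ideal_def
proof (intro conjI)
  show "\<O> \<noteq> {0}" using one_mem by fastforce
  show "\<exists>d\<in>\<O>. d \<noteq> 0 \<and> (\<forall>x\<in>\<O>. d * x \<in> \<O>)" by (intro bexI[of _ 1]) auto
qed (auto simp: cyc_int_subset)

lemma princ_eq: "princ z x = (*) x ` \<O>"
  unfolding princ_def by auto

lemma frac_scale:
  assumes "fideal I" "x \<in> \<K>" "x \<noteq> 0"
  shows "fideal ((*) x ` I)"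
proof -
  obtain d where d: "d \<in> \<O>" "d \<noteq> 0" "\<forall>y\<in>I. d * y \<in> \<O>"
    using assms(1) unfolding fractional_ideal_def by blast
  obtain y n where y: "y \<in> \<O>" "n \<noteq> 0" "x = y / of_int n" using assms(2) by (rule cyc_field_E)
  have "of_int n * d * (x * w) = y * (d * w)" for w using y(2) by (simp add: y(3))
  moreover have "y * (d * w) \<in> \<O>" if "w \<in> I" for w using that y(1) d(3) by blast
  ultimately have "\<forall>w\<in>(*) x ` I. of_int n * d * w \<in> \<O>" by (metis imageE)
  moreover have "of_int n * d \<noteq> 0" using d y by simp
  ultimately have "\<exists>d\<in>\<O>. d \<noteq> 0 \<and> (\<forall>w\<in>(*) x ` I. d * w \<in> \<O>)"
    using d(1) by (intro bexI[of _ "of_int n * d"]) auto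
  moreover obtain a where "a \<in> I" "a \<noteq> 0" using frac_nonzero assms(1) by blast
  then have "x * a \<in> (*) x ` I" "x * a \<noteq> 0" using assms(3) by auto
  then have "(*) x ` I \<noteq> {0}" by blast
  moreover have "(*) x ` I \<subseteq> \<K>" using assms(2) fracD(1)[OF assms(1)] by blast
  moreover have "0 \<in> (*) x ` I" using fracD(2)[OF assms(1)] by (intro image_eqI[of _ _ 0]) auto
  moreover have "v + w \<in> (*) x ` I" if "v \<in> (*) x ` I" "w \<in> (*) x ` I" for v w
  proof -
    from that obtain a b where "v = x * a" "a \<in> I" "w = x * b" "b \<in> I" by blast
    then show ?thesis using fracD(3)[OF assms(1)]
      by (intro image_eqI[of _ _ "a + b"]) (simp_all add: distrib_left)
  qed
  moreover have "r * w \<in> (*) x ` I" if "r \<in> \<O>" "w \<in> (*) x ` I" for r w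
  proof -
    from that obtain b where "w = x * b" "b \<in> I" by blast
    then show ?thesis using fracD(4)[OF assms(1) that(1)]
      by (intro image_eqI[of _ _ "r * b"]) simp_all
  qed
  ultimately show ?thesis unfolding fractional_ideal_def by blast
qed

lemma frac_princ: "x \<in> \<K> \<Longrightarrow> x \<noteq> 0 \<Longrightarrow> fideal (princ z x)"
  unfolding princ_eq by (intro frac_scale frac_cyc_int)

lemma ideal_mult_scale: "ideal_mult ((*) x ` I) J = (*) x ` ideal_mult I J"
proof
  show "ideal_mult ((*) x ` I) J \<subseteq> (*) x ` ideal_mult I J"
  proof
    fix y assume "y \<in> ideal_mult ((*) x ` I) J"
    then show "y \<in> (*) x ` ideal_mult I J"
    proof (induction rule: ideal_mult_induct)
      case (add y a b)
      then obtain w a' where "y = x * w" "w \<in> ideal_mult I J" "a = x * a'" "a' \<in> I" by blast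
      then show ?case using add by (intro image_eqI[of _ _ "w + a' * b"])
          (auto simp: algebra_simps intro: ideal_mult_add_product)
    qed (auto intro: image_eqI[of _ _ 0])
  qed
  show "(*) x ` ideal_mult I J \<subseteq> ideal_mult ((*) x ` I) J"
  proof clarify
    fix y assume "y \<in> ideal_mult I J"
    then show "x * y \<in> ideal_mult ((*) x ` I) J"
    proof (induction rule: ideal_mult_induct)
      case (add y a b)
      then have "x * y + (x * a) * b \<in> ideal_mult ((*) x ` I) J"
        by (intro ideal_mult_add_product) auto
      then show ?case by (simp add: algebra_simps)
    qed simp
  qed
qed

lemma ideal_mult_one: "fideal I \<Longrightarrow> ideal_mult \<O> I = I"
proof
  assume I: "fideal I"
  show "ideal_mult \<O> I \<subseteq> I"
  proof
    fix x assume "x \<in> ideal_mult \<O> I"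
    then show "x \<in> I" by (induction rule: ideal_mult_induct) (use I in \<open>auto simp: fracD\<close>)
  qed
  show "I \<subseteq> ideal_mult \<O> I" using ideal_mult_product[of 1 \<O> _ I] by auto
qed

lemma ideal_mult_princ: "fideal I \<Longrightarrow> ideal_mult (princ z x) I = (*) x ` I"
  unfolding princ_eq ideal_mult_scale by (simp add: ideal_mult_one)

text \<open>Inverses will occur only for classes with \<open>c ^ p = 1\<close>, where
  \<open>c ^ (p - 1)\<close> is the inverse, so the monoid structure is the setting for all that
  follows.\<close>

sublocale IG: comm_monoid "ideal_group z"
  rewrites "carrier (ideal_group z) = {I. fideal I}"
    and "monoid.mult (ideal_group z) = ideal_mult"
    and "one (ideal_group z) = \<O>"
proof -
  show "comm_monoid IG"
  proof (rule comm_monoidI)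
    show "\<And>x y. x \<otimes>\<^bsub>IG\<^esub> y = y \<otimes>\<^bsub>IG\<^esub> x"
      unfolding ideal_group_def by (simp add: ideal_mult_commute)
  qed (auto simp: ideal_group_def frac_mult frac_cyc_int ideal_mult_assoc ideal_mult_one)
qed (simp_all add: ideal_group_def)

lemma ideal_group_simps [simp]:
  "carrier IG = {I. fideal I}" "monoid.mult IG = ideal_mult" "one IG = \<O>"
  by (simp_all add: ideal_group_def)

lemma frac_power [simp]: "fideal I \<Longrightarrow> fideal (I [^]\<^bsub>IG\<^esub> (n::nat))"
  using IG.nat_pow_closed by simp

lemma princ_mult: "x \<in> \<K> \<Longrightarrow> y \<in> \<K> \<Longrightarrow> y \<noteq> 0 \<Longrightarrow> ideal_mult (princ z x) (princ z y) = princ z (x * y)"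
  by (subst ideal_mult_princ, erule (1) frac_princ) (simp add: princ_eq image_image mult.assoc)

lemma princ_1: "princ z 1 = \<O>"
  by (simp add: princ_eq)

lemma princ_power:
  assumes "x \<in> \<K>" "x \<noteq> 0"
  shows "princ z x [^]\<^bsub>IG\<^esub> (n::nat) = princ z (x ^ n)"
proof (induction n)
  case (Suc n)
  then show ?case using princ_mult[of "x ^ n" x] assms by (simp add: mult.commute)
qed (simp add: princ_1)

lemma scale_power:
  assumes "fideal I" "x \<in> \<K>" "x \<noteq> 0"
  shows "((*) x ` I) [^]\<^bsub>IG\<^esub> (n::nat) = (*) (x ^ n) ` (I [^]\<^bsub>IG\<^esub> n)"
proof -
  have "ideal_mult (princ z x) I [^]\<^bsub>IG\<^esub> n
      = ideal_mult (princ z x [^]\<^bsub>IG\<^esub> n) (I [^]\<^bsub>IG\<^esub> n)"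
    using frac_princ[OF assms(2,3)] assms(1) by (intro IG.pow_mult_distrib ideal_mult_commute) auto
  then show ?thesis
    unfolding ideal_mult_princ[OF assms(1)] princ_power[OF assms(2,3)]
      ideal_mult_princ[OF frac_power[OF assms(1)]] .
qed

lemma princ_eq_imp_unit:
  assumes "princ z x = princ z y" "y \<noteq> 0"
  obtains e e' where "e \<in> \<O>" "e' \<in> \<O>" "e * e' = 1" "x = e * y"
proof -
  have "x \<in> princ z x" "y \<in> princ z y" unfolding princ_eq by force+
  then have "x \<in> princ z y" "y \<in> princ z x" using assms(1) by auto
  then obtain e e' where e: "e \<in> \<O>" "x = y * e" "e' \<in> \<O>" "y = x * e'"
    unfolding princ_eq by blast
  then have "y * (e * e') = y * 1" by (metis mult.assoc mult_1_right)
  then have "e * e' = 1" using assms(2) mult_left_cancel by blast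
  with e show ?thesis using that[of e e'] by (simp add: mult.commute)
qed

lemma unit_princ: "e \<in> \<O> \<Longrightarrow> e' \<in> \<O> \<Longrightarrow> e * e' = 1 \<Longrightarrow> princ z (e * x) = princ z x"
proof -
  assume e: "e \<in> \<O>" "e' \<in> \<O>" "e * e' = 1"
  have "x * r = e * x * (e' * r)" for r
  proof -
    have "e * x * (e' * r) = (e * e') * (x * r)" by (simp add: mult_ac)
    then show ?thesis using e(3) by simp
  qed
  moreover have "e * x * r = x * (e * r)" for r by (simp add: mult_ac)
  ultimately have "y \<in> princ z (e * x) \<longleftrightarrow> y \<in> princ z x" for y
    using mult_mem[OF e(1)] mult_mem[OF e(2)] unfolding princ_def mem_Collect_eq by metis
  then show ?thesis by blast
qed

lemma power_mem_ideal_power: "a \<in> I \<Longrightarrow> a ^ n \<in> I [^]\<^bsub>IG\<^esub> (n::nat)"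
  by (induction n) (auto intro: ideal_mult_product simp: mult.commute[of a])

text \<open>The ideal group has no torsion, since the ring is integrally closed.\<close>

lemma ideal_power_eq_one:
  assumes "fideal J" "J [^]\<^bsub>IG\<^esub> p = \<O>"
  shows "J = \<O>"
proof -
  have sub: "J \<subseteq> \<O>"
  proof
    fix a assume "a \<in> J"
    then have "a ^ p \<in> \<O>" using power_mem_ideal_power[of a J p] assms(2) by simp
    moreover have "a \<in> \<K>" using \<open>a \<in> J\<close> by (rule fracD(1)[OF assms(1)])
    ultimately show "a \<in> \<O>" by (rule integrally_closed[rotated])
  qed
  have pow_sub: "J [^]\<^bsub>IG\<^esub> (n::nat) \<subseteq> \<O>" for n
  proof (induction n)
    case (Suc n)
    then have "ideal_mult (J [^]\<^bsub>IG\<^esub> n) J \<subseteq> ideal_mult \<O> \<O>" using sub by (rule ideal_mult_mono)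
    then show ?case by (simp add: ideal_mult_one frac_cyc_int)
  qed simp
  obtain n where n: "p = Suc n" using p_gt_0 gr0_implies_Suc by blast
  have "\<O> = ideal_mult (J [^]\<^bsub>IG\<^esub> n) J" using assms(2) by (simp add: n)
  also have "\<dots> \<subseteq> ideal_mult \<O> J" by (intro ideal_mult_mono pow_sub subset_refl)
  also have "\<dots> = J" using assms(1) by (rule ideal_mult_one)
  finally show ?thesis using sub by blast
qed

lemma ideal_class_eq:
  assumes "fideal I"
  shows "cls I = {(*) x ` I | x. x \<in> \<K> \<and> x \<noteq> 0}"
proof -
  have "cls I = {ideal_mult (princ z x) I | x. x \<in> \<K> \<and> x \<noteq> 0}"
    unfolding ideal_class_def r_coset_def principal_ideals_def ideal_group_simps by blast
  then show ?thesis by (simp only: ideal_mult_princ[OF assms])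
qed

lemma scale_scale: "(*) x ` (*) y ` I = (*) (x * y) ` I" for x :: complex
  by (simp add: image_image mult.assoc)

lemma mem_ideal_class: "fideal I \<Longrightarrow> I \<in> cls I"
  unfolding ideal_class_eq by (auto intro!: exI[of _ 1])

lemma ideal_class_scale:
  assumes "fideal I" "x \<in> \<K>" "x \<noteq> 0"
  shows "cls ((*) x ` I) = cls I"
  unfolding ideal_class_eq[OF assms(1)] ideal_class_eq[OF frac_scale[OF assms]] scale_scale
proof (intro subset_antisym subsetI; elim CollectE exE conjE)
  fix L y assume "L = (*) (y * x) ` I" "y \<in> \<K>" "y \<noteq> 0"
  then show "L \<in> {(*) y ` I | y. y \<in> \<K> \<and> y \<noteq> 0}"
    using assms(2,3) by (intro CollectI exI[of _ "y * x"]) simp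
next
  fix L y assume "L = (*) y ` I" "y \<in> \<K>" "y \<noteq> 0"
  then show "L \<in> {(*) (y * x) ` I | y. y \<in> \<K> \<and> y \<noteq> 0}"
    using assms(2,3) by (intro CollectI exI[of _ "y / x"]) simp
qed

lemma principal_ideals_eq: "principal_ideals z = cls \<O>"
  unfolding ideal_class_eq[OF frac_cyc_int] principal_ideals_def princ_eq ..

lemma ideal_class_mult:
  assumes "fideal I" "fideal J"
  shows "cls I <#>\<^bsub>IG\<^esub> cls J = cls (ideal_mult I J)"
proof -
  have *: "ideal_mult ((*) x ` I) ((*) y ` J) = (*) (x * y) ` ideal_mult I J" for x y
    by (metis ideal_mult_scale ideal_mult_commute scale_scale)
  show ?thesis
    unfolding set_mult_def ideal_class_eq[OF assms(1)] ideal_class_eq[OF assms(2)]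
      ideal_class_eq[OF frac_mult[OF assms]] ideal_group_simps
  proof (intro subset_antisym subsetI)
    fix L assume "L \<in> (\<Union>h\<in>{(*) x ` I |x. x \<in> \<K> \<and> x \<noteq> 0}.
      \<Union>k\<in>{(*) x ` J |x. x \<in> \<K> \<and> x \<noteq> 0}. {ideal_mult h k})"
    then obtain x y where "x \<in> \<K>" "x \<noteq> 0" "y \<in> \<K>" "y \<noteq> 0"
      "L = ideal_mult ((*) x ` I) ((*) y ` J)" by blast
    then show "L \<in> {(*) x ` ideal_mult I J |x. x \<in> \<K> \<and> x \<noteq> 0}"
      unfolding * by (intro CollectI exI[of _ "x * y"]) auto
  next
    fix L assume "L \<in> {(*) x ` ideal_mult I J |x. x \<in> \<K> \<and> x \<noteq> 0}"
    then obtain x where x: "x \<in> \<K>" "x \<noteq> 0" "L = (*) x ` ideal_mult I J" by blast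
    have "L = ideal_mult ((*) x ` I) ((*) 1 ` J)" unfolding * x(3) by simp
    moreover have J: "(*) 1 ` J \<in> {(*) x ` J |x. x \<in> \<K> \<and> x \<noteq> 0}"
      by (rule CollectI, rule exI[of _ 1]) simp
    moreover have I: "(*) x ` I \<in> {(*) x ` I |x. x \<in> \<K> \<and> x \<noteq> 0}" using x(1,2) by blast
    ultimately show "L \<in> (\<Union>h\<in>{(*) x ` I |x. x \<in> \<K> \<and> x \<noteq> 0}.
      \<Union>k\<in>{(*) x ` J |x. x \<in> \<K> \<and> x \<noteq> 0}. {ideal_mult h k})"
      by (intro UN_I[OF I] UN_I[OF J]) (simp only: singleton_iff)
  qed
qed

lemma class_group_carrier: "carrier CG = cls ` {I. fideal I}"
  unfolding class_group_def FactGroup_def RCOSETS_def ideal_class_def by auto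

lemma class_group_mult:
  "fideal I \<Longrightarrow> fideal J \<Longrightarrow> cls I \<otimes>\<^bsub>CG\<^esub> cls J = cls (ideal_mult I J)"
  using ideal_class_mult by (simp add: class_group_def FactGroup_def)

lemma class_group_one: "\<one>\<^bsub>CG\<^esub> = cls \<O>"
  by (simp add: class_group_def FactGroup_def principal_ideals_eq)

sublocale CG: comm_monoid "class_group z"
proof (rule comm_monoidI)
  fix c d assume "c \<in> carrier CG" "d \<in> carrier CG"
  then obtain I J where "fideal I" "fideal J" "c = cls I" "d = cls J"
    unfolding class_group_carrier by blast
  then show "c \<otimes>\<^bsub>CG\<^esub> d = d \<otimes>\<^bsub>CG\<^esub> c"
    by (simp only: class_group_mult ideal_mult_commute[of I J])
qed (auto simp: class_group_carrier class_group_mult class_group_one frac_mult frac_cyc_int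
    ideal_mult_assoc ideal_mult_one)

lemma class_power: "fideal I \<Longrightarrow> cls I [^]\<^bsub>CG\<^esub> (n::nat) = cls (I [^]\<^bsub>IG\<^esub> n)"
  by (induction n) (simp_all add: class_group_one class_group_mult)

section \<open>Galois action on ideals and classes\<close>

context
  fixes \<tau> k
  assumes gal: "galois_aut z \<tau>" and tau_z: "\<tau> z = z ^ k" and k: "\<not> p dvd k"
begin

lemma aut_image_field: "\<tau> ` \<K> = \<K>"
  using gal by (simp add: galois_aut_def bij_betw_def)

text \<open>For surjectivity, an inverse \<open>l\<close> of \<open>k\<close> modulo
  \<open>p\<close> gives the preimage \<open>ev a l\<close> of \<open>ev a 1\<close>.\<close>

lemma aut_image_int: "\<tau> ` \<O> = \<O>"
proof
  show "\<tau> ` \<O> \<subseteq> \<O>" using aut_mem[OF gal tau_z] by blast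
  have "coprime k p" using k prime_p by (metis coprime_commute prime_imp_coprime)
  then obtain l where "[k * l = Suc 0] (mod p)" using cong_solve_coprime_nat by blast
  then have l: "[k * l = 1] (mod p)" by simp
  show "\<O> \<subseteq> \<tau> ` \<O>"
  proof
    fix x assume "x \<in> \<O>"
    then obtain a where "x = ev a 1" by (rule cyc_int_rep)
    then have "x = \<tau> (ev a l)" using aut_ev[OF gal tau_z] ev_cong[OF l] by metis
    then show "x \<in> \<tau> ` \<O>" by blast
  qed
qed

lemma aut_scale: "x \<in> \<K> \<Longrightarrow> I \<subseteq> \<K> \<Longrightarrow> \<tau> ` (*) x ` I = (*) (\<tau> x) ` \<tau> ` I"
  by (auto simp: image_image aut_mult[OF gal tau_z] subset_iff intro!: image_cong)

lemma aut_frac: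
  assumes "fideal I"
  shows "fideal (\<tau> ` I)"
proof -
  note [simp] = fracD[OF assms] aut_0[OF gal tau_z]
  obtain d where d: "d \<in> \<O>" "d \<noteq> 0" "\<forall>x\<in>I. d * x \<in> \<O>"
    using assms unfolding fractional_ideal_def by blast
  have "\<tau> d * \<tau> x \<in> \<O>" if "x \<in> I" for x
    using d(3) that aut_mult[OF gal tau_z, of d x] aut_mem[OF gal tau_z, of "d * x"]
    by (simp add: cyc_int_subset d(1))
  moreover have "\<tau> d \<noteq> 0" using d aut_eq_0_iff[OF gal tau_z] cyc_int_subset by blast
  ultimately have "\<exists>d\<in>\<O>. d \<noteq> 0 \<and> (\<forall>x\<in>\<tau> ` I. d * x \<in> \<O>)"
    using aut_mem[OF gal tau_z d(1)] by blast
  moreover have "\<forall>r\<in>\<O>. \<forall>x\<in>\<tau> ` I. r * x \<in> \<tau> ` I"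
  proof clarify
    fix r x assume r: "r \<in> \<O>" and x: "x \<in> I"
    from r obtain s where "s \<in> \<O>" "r = \<tau> s" using aut_image_int by blast
    then show "r * \<tau> x \<in> \<tau> ` I"
      using x by (intro image_eqI[of _ _ "s * x"]) (auto simp: aut_mult[OF gal tau_z] cyc_int_subset)
  qed
  moreover have "\<forall>x\<in>\<tau> ` I. \<forall>y\<in>\<tau> ` I. x + y \<in> \<tau> ` I"
  proof clarify
    fix x y assume "x \<in> I" "y \<in> I"
    then show "\<tau> x + \<tau> y \<in> \<tau> ` I"
      by (intro image_eqI[of _ _ "x + y"]) (auto simp: aut_add[OF gal tau_z])
  qed
  moreover have "\<tau> ` I \<subseteq> \<K>" using aut_closed[OF gal] fracD(1)[OF assms] by blast
  moreover have "0 \<in> \<tau> ` I" by (rule image_eqI[of _ _ 0]) auto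
  moreover obtain a where a: "a \<in> I" "a \<noteq> 0" using frac_nonzero assms by blast
  then have "\<tau> a \<noteq> 0" using aut_eq_0_iff[OF gal tau_z] by simp
  then have "\<tau> ` I \<noteq> {0}" using a by blast
  ultimately show ?thesis unfolding fractional_ideal_def by blast
qed

lemma aut_princ: "x \<in> \<K> \<Longrightarrow> \<tau> ` princ z x = princ z (\<tau> x)"
  unfolding princ_eq by (subst aut_scale) (auto simp: aut_image_int cyc_int_subset)

lemma aut_ideal_mult:
  assumes "fideal I" "fideal J"
  shows "\<tau> ` ideal_mult I J = ideal_mult (\<tau> ` I) (\<tau> ` J)"
proof -
  note IK = fracD(1)[OF assms(1)] and JK = fracD(1)[OF assms(2)]
    and IJK = fracD(1)[OF frac_mult[OF assms]]
  have step: "\<tau> (x + a * b) = \<tau> x + \<tau> a * \<tau> b"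
    if "x \<in> ideal_mult I J" "a \<in> I" "b \<in> J" for x a b
    using that IK JK IJK by (simp add: aut_add[OF gal tau_z] aut_mult[OF gal tau_z])
  show ?thesis
  proof
    show "\<tau> ` ideal_mult I J \<subseteq> ideal_mult (\<tau> ` I) (\<tau> ` J)"
    proof clarify
      fix x assume "x \<in> ideal_mult I J"
      then show "\<tau> x \<in> ideal_mult (\<tau> ` I) (\<tau> ` J)"
        by (induction rule: ideal_mult_induct)
          (auto simp: step aut_0[OF gal tau_z] intro: ideal_mult_add_product)
    qed
    show "ideal_mult (\<tau> ` I) (\<tau> ` J) \<subseteq> \<tau> ` ideal_mult I J"
    proof
      fix x assume "x \<in> ideal_mult (\<tau> ` I) (\<tau> ` J)"
      then show "x \<in> \<tau> ` ideal_mult I J"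
      proof (induction rule: ideal_mult_induct)
        case zero
        show ?case by (rule image_eqI[of _ _ 0]) (auto simp: aut_0[OF gal tau_z])
      next
        case (add x a b)
        then obtain y c d where "x = \<tau> y" "y \<in> ideal_mult I J" "a = \<tau> c" "c \<in> I" "b = \<tau> d" "d \<in> J"
          by blast
        then show ?case
          by (intro image_eqI[of _ _ "y + c * d"]) (auto simp: step intro: ideal_mult_add_product)
      qed
    qed
  qed
qed

lemma aut_ideal_power: "fideal I \<Longrightarrow> \<tau> ` (I [^]\<^bsub>IG\<^esub> (n::nat)) = (\<tau> ` I) [^]\<^bsub>IG\<^esub> n"
  by (induction n) (simp_all add: aut_image_int aut_ideal_mult)

lemma act_class_eq:
  assumes "fideal I"
  shows "act_class \<tau> (cls I) = cls (\<tau> ` I)"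
proof -
  have IK: "I \<subseteq> \<K>" using fracD(1)[OF assms] by blast
  have "act_class \<tau> (cls I) = {(*) (\<tau> x) ` \<tau> ` I | x. x \<in> \<K> \<and> x \<noteq> 0}"
    unfolding act_class_def ideal_class_eq[OF assms]
    using aut_scale[OF _ IK] by (auto simp: image_iff) metis+
  also have "\<dots> = {(*) x ` \<tau> ` I | x. x \<in> \<K> \<and> x \<noteq> 0}"
  proof -
    have "\<exists>y. y \<in> \<K> \<and> y \<noteq> 0 \<and> x = \<tau> y" if "x \<in> \<K>" "x \<noteq> 0" for x
    proof -
      from that obtain y where "y \<in> \<K>" "x = \<tau> y" using aut_image_field by blast
      then show ?thesis using that aut_0[OF gal tau_z] by auto
    qed
    moreover have "\<tau> x \<in> \<K> \<and> \<tau> x \<noteq> 0" if "x \<in> \<K>" "x \<noteq> 0" for x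
      using that aut_closed[OF gal] aut_eq_0_iff[OF gal tau_z] by blast
    ultimately show ?thesis by blast
  qed
  finally show ?thesis unfolding ideal_class_eq[OF aut_frac[OF assms]] .
qed

end

lemma pi_ideal_power: "pi_ideal z [^]\<^bsub>IG\<^esub> (k::nat) = {x. dv (\<pi> ^ k) x}"
  unfolding pi_ideal_def by (subst princ_power) (auto simp: cyc_int_subset princ_def dv_def)

lemma pi_ideal_eq: "pi_ideal z = {x. dv \<pi> x}"
  unfolding pi_ideal_def princ_def dv_def by auto

text \<open>For integral \<open>x\<close> the denominator \<open>d\<close>, being prime to
  \<open>\<pi>\<close>, cancels; the localized congruences of the definitions thus become
  \<open>dv\<close> relations in the ring.\<close>

lemma pi_power_loc_iff:
  assumes "x \<in> \<O>"
  shows "x \<in> pi_power_loc z k \<longleftrightarrow> dv (\<pi> ^ k) x"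
proof
  assume "x \<in> pi_power_loc z k"
  then have "\<exists>d\<in>\<O> - {x. dv \<pi> x}. d * x \<in> {x. dv (\<pi> ^ k) x}"
    unfolding pi_power_loc_def pi_ideal_power unfolding pi_ideal_eq by (simp only: mem_Collect_eq)
  then obtain d where "d \<in> \<O> - {x. dv \<pi> x}" "d * x \<in> {x. dv (\<pi> ^ k) x}" by (rule bexE)
  then show "dv (\<pi> ^ k) x" using pi_power_dv_cancel[of d x k] assms by simp
next
  assume "dv (\<pi> ^ k) x"
  then show "x \<in> pi_power_loc z k"
    unfolding pi_power_loc_def pi_ideal_power unfolding pi_ideal_eq
    using assms pi_not_dv_1 by (auto simp: cyc_int_subset intro!: bexI[of _ 1])
qed

section \<open>Singular negative integers\<close>

lemma not_p_dvd_u: "\<not> p dvd u"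
  using coprime_p_u prime_p by (metis coprime_absorb_left not_prime_unit)

lemma not_p_dvd_p_minus_1: "\<not> p dvd p - 1"
  using p_ge_3 by (auto dest: dvd_imp_le)

lemmas sigma_aut = galois_sigma sigma_z
lemmas cnj_aut = galois_cnj cnj_z_power
lemmas sigma_aut_coprime = galois_sigma sigma_z not_p_dvd_u
lemmas cnj_aut_coprime = galois_cnj cnj_z_power not_p_dvd_p_minus_1

lemma power_p: "x ^ p = x * x ^ (p - 1)" for x :: complex
  by (metis p_gt_0 power_minus_mult mult.commute)

lemmas pi_power_dv_cancel_iff = dv_cancel[OF power_not_zero[OF pi_neq_0]]

lemma cong_root_of_unity_1: "dv \<pi> (z ^ i - 1)"
proof -
  have "dv \<pi> (z - 1)" using dv_minus_commute[of \<pi> 1 z] by auto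
  from dvc_power[OF this, of i] show ?thesis by simp
qed

lemma pi_dv_aut:
  assumes "galois_aut z \<tau>" "\<tau> z = z ^ l" "dv (\<pi> ^ k) x"
  shows "dv (\<pi> ^ k) (\<tau> x)"
proof -
  have "\<tau> \<pi> = 1 - z ^ l"
    using aut_add[OF assms(1,2), of \<pi> z] aut_1[OF assms(1,2)] assms(2)
    by (simp add: cyc_int_subset algebra_simps)
  then have "dv \<pi> (\<tau> \<pi>)" using cong_root_of_unity_1[of l] by (simp only: dv_minus_commute)
  then have "dv (\<pi> ^ k) (\<tau> (\<pi> ^ k))"
    by (simp only: aut_power_int[OF assms(1,2)] pi_mem dv_power)
  moreover have "dv (\<tau> (\<pi> ^ k)) (\<tau> x)" by (rule aut_dv[OF assms]) auto
  ultimately show ?thesis by (rule dv_trans)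
qed

lemma aut_diff_of_int:
  assumes "galois_aut z \<tau>" "\<tau> z = z ^ l" "x \<in> \<O>"
  shows "\<tau> (x - of_int n) = \<tau> x - of_int n"
proof -
  have "\<tau> ((x - of_int n) + of_int n) = \<tau> (x - of_int n) + \<tau> (of_int n)"
    using assms(3) by (intro aut_add[OF assms(1,2)]) (auto intro: cyc_int_subset)
  then show ?thesis by (simp add: aut_of_int[OF assms(1,2)])
qed

lemma aut_cong_int:
  assumes "galois_aut z \<tau>" "\<tau> z = z ^ l" "x \<in> \<O>" "dv (\<pi> ^ k) (x - of_int n)"
  shows "dv (\<pi> ^ k) (\<tau> x - of_int n)"
  using pi_dv_aut[OF assms(1,2,4)] by (simp only: aut_diff_of_int[OF assms(1-3)])

lemma cong_1_power_p_minus_1: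
  assumes "x \<in> \<O>" "\<not> dv \<pi> x"
  shows "dv \<pi> (x ^ (p - 1) - 1)"
proof -
  obtain n where n: "dv \<pi> (x - of_int n)" using assms(1) by (rule cong_int_mod_pi)
  have "dv \<pi> (of_int n ^ p - of_int n)"
    using cong_int_prime_power[OF prime_p] pi_dv_p dv_trans by blast
  moreover have "of_int n ^ p - of_int n = of_int n * (of_int n ^ (p - 1) - 1 :: complex)"
    by (simp only: power_p[of "of_int n"] right_diff_distrib mult_1_right)
  ultimately have "dv \<pi> (of_int n * (of_int n ^ (p - 1) - 1))" by (simp only:)
  moreover have "\<not> dv \<pi> (of_int n)" using assms(2) n cong_dv_iff by blast
  ultimately have "dv \<pi> (of_int n ^ (p - 1) - 1)" by (subst (asm) pi_prime) auto
  moreover have "dv \<pi> (x ^ (p - 1) - of_int n ^ (p - 1))" using n assms(1) by (intro dvc_power) auto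
  ultimately show ?thesis by (rule dvc_trans[rotated])
qed

lemma pi_square_dv_pi_power_p: "dv (\<pi>\<^sup>2) (\<pi> ^ p)"
  using p_ge_3 by (intro dv_power_le) auto

lemma pi_square_dv_p: "dv (\<pi>\<^sup>2) (of_nat p)"
proof -
  have "dv (\<pi>\<^sup>2) (\<pi> ^ (p - 1))" using p_ge_3 by (intro dv_power_le) auto
  then show ?thesis using pi_power_dv_p dv_trans by blast
qed

text \<open>Every residue modulo \<open>\<pi>\<close> is an integer, and \<open>cong_power_p\<close>
  lifts the congruence; unknown \<open>p\<close>-th powers thereby turn into integers at precision
  \<open>\<pi> ^ p\<close>.\<close>

lemma power_p_cong_int:
  assumes "x \<in> \<O>" "\<not> dv \<pi> x"
  obtains n where "\<not> int p dvd n" "dv (\<pi> ^ p) (x ^ p - of_int n ^ p)"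
proof -
  obtain n where n: "dv \<pi> (x - of_int n)" using assms(1) by (rule cong_int_mod_pi)
  have "\<not> dv \<pi> (of_int n)" using assms(2) n cong_dv_iff by blast
  moreover have "dv (\<pi> ^ p) (x ^ p - of_int n ^ p)" using n of_int_mem by (rule cong_power_p)
  ultimately show ?thesis using that by (simp only: pi_dv_int_iff)
qed

text \<open>The class of \<open>cnj I\<close> is the inverse of that of \<open>I\<close>, hence its
  \<open>(p - 1)\<close>-st power, say \<open>cnj I = x * I ^ (p - 1)\<close>. So
  \<open>cnj I * I = x * I ^ p\<close> has the explicit generator \<open>x * B\<close>, and the
  \<open>p\<close>-th power of this equation compares generators.\<close>

lemma minus_class_norm:
  assumes I: "fideal I" and B: "B \<in> \<O>" "B \<noteq> 0" "princ z B = I [^]\<^bsub>IG\<^esub> p"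
    and minus: "cls I \<in> class_p_minus p z"
  obtains g e e' where "g \<in> \<K>" "e \<in> \<O>" "e' \<in> \<O>" "e * e' = 1" "B * cnj B = e * g ^ p"
proof -
  define c where "c = cls I"
  have c: "c \<in> carrier CG" "act_class cnj c = inv\<^bsub>CG\<^esub> c" "c [^]\<^bsub>CG\<^esub> p = \<one>\<^bsub>CG\<^esub>"
    using minus unfolding class_p_minus_def class_p_def c_def by auto
  have BK: "B \<in> \<K>" using B by (simp add: cyc_int_subset)
  obtain n where n: "p = Suc n" using p_gt_0 gr0_implies_Suc by blast
  have "c [^]\<^bsub>CG\<^esub> n \<otimes>\<^bsub>CG\<^esub> c = \<one>\<^bsub>CG\<^esub>" using c(3) n by simp
  then have "c [^]\<^bsub>CG\<^esub> n = inv\<^bsub>CG\<^esub> c"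
    using c(1) CG.m_comm by (intro CG.inv_unique') auto
  then have "cls (cnj ` I) = cls (I [^]\<^bsub>IG\<^esub> n)"
    using c(2) act_class_eq[OF cnj_aut_coprime I] class_power[OF I] by (simp add: c_def)
  then have "cnj ` I \<in> cls (I [^]\<^bsub>IG\<^esub> n)"
    using mem_ideal_class[OF aut_frac[OF cnj_aut_coprime I]] by simp
  then obtain x where x: "x \<in> \<K>" "x \<noteq> 0" "cnj ` I = (*) x ` (I [^]\<^bsub>IG\<^esub> n)"
    unfolding ideal_class_eq[OF frac_power[OF I]] by blast
  have "ideal_mult (cnj ` I) I = (*) x ` (I [^]\<^bsub>IG\<^esub> p)"
    unfolding x(3) ideal_mult_scale by (simp add: n)
  also have "\<dots> = princ z (x * B)"
    unfolding B(3)[symmetric] princ_eq by (simp add: image_image mult.assoc)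
  finally have g: "ideal_mult (cnj ` I) I = princ z (x * B)" .
  have "princ z ((x * B) ^ p) = ideal_mult (cnj ` I) I [^]\<^bsub>IG\<^esub> p"
    unfolding g using x BK B(2) by (intro princ_power[symmetric]) auto
  also have "\<dots> = ideal_mult ((cnj ` I) [^]\<^bsub>IG\<^esub> p) (I [^]\<^bsub>IG\<^esub> p)"
    using I aut_frac[OF cnj_aut_coprime I] by (intro IG.pow_mult_distrib ideal_mult_commute) auto
  also have "(cnj ` I) [^]\<^bsub>IG\<^esub> p = princ z (cnj B)"
    unfolding aut_ideal_power[OF cnj_aut_coprime I, symmetric] B(3)[symmetric] by (rule aut_princ[OF cnj_aut_coprime BK])
  also have "ideal_mult (princ z (cnj B)) (I [^]\<^bsub>IG\<^esub> p) = princ z (cnj B * B)"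
    unfolding B(3)[symmetric] using BK B(2) by (intro princ_mult) auto
  finally have "princ z (B * cnj B) = princ z ((x * B) ^ p)" by (simp add: mult.commute)
  moreover have "(x * B) ^ p \<noteq> 0" using x B by simp
  ultimately obtain e e' where "e \<in> \<O>" "e' \<in> \<O>" "e * e' = 1" "B * cnj B = e * (x * B) ^ p"
    by (rule princ_eq_imp_unit)
  then show ?thesis using that[of "x * B"] x BK by blast
qed

text \<open>With \<open>N = B * cnj B = e * g ^ p\<close> real one has \<open>N\<^sup>2 = (e * cnj e) * (g * cnj g) ^ p\<close>, and
  \<open>N = (N\<^sup>2) ^ ((p + 1) div 2) / N ^ p\<close>; so the unit can be taken to be a power of the relative
  norm \<open>e * cnj e\<close>.\<close>

lemma minus_class_norm_real:
  assumes "fideal I" "B \<in> \<O>" "B \<noteq> 0" "princ z B = I [^]\<^bsub>IG\<^esub> p" "cls I \<in> class_p_minus p z"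
  obtains \<eta> \<eta>' \<beta> where "\<eta> \<in> real_cyc_int z" "\<eta>' \<in> real_cyc_int z" "\<eta> * \<eta>' = 1"
    "\<eta> \<in> \<O>" "\<eta>' \<in> \<O>" "\<beta> \<in> \<O>" "B * cnj B = \<eta> * \<beta> ^ p"
proof -
  obtain g e e' where g: "g \<in> \<K>" "e \<in> \<O>" "e' \<in> \<O>" "e * e' = 1" "B * cnj B = e * g ^ p"
    using assms by (rule minus_class_norm)
  obtain m where m: "p = 2 * m + 1" using odd_p by (rule oddE)
  define N where "N = B * cnj B"
  define \<eta> where "\<eta> = (e * cnj e) ^ (m + 1)"
  define \<eta>' where "\<eta>' = (e' * cnj e') ^ (m + 1)"
  define \<beta> where "\<beta> = (g * cnj g) ^ (m + 1) / N"
  interpret R: ring_set "real_cyc_int z" unfolding real_cyc_int_def by (rule int_adjoin_ring_set)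
  have N0: "N \<noteq> 0" using assms(3) by (simp add: N_def)
  have mem: "\<eta> \<in> \<O>" "\<eta>' \<in> \<O>" using g by (auto simp: \<eta>_def \<eta>'_def)
  have real: "\<eta> \<in> real_cyc_int z" "\<eta>' \<in> real_cyc_int z"
    unfolding \<eta>_def \<eta>'_def using g(2,3) by (auto intro!: R.power_mem norm_mem_real_cyc_int)
  have "\<eta> * \<eta>' = ((e * e') * cnj (e * e')) ^ (m + 1)"
    by (simp add: \<eta>_def \<eta>'_def mult_ac flip: power_mult_distrib)
  then have unit: "\<eta> * \<eta>' = 1" using g(4) by simp
  have "\<eta> * ((g * cnj g) ^ (m + 1)) ^ p = ((e * g ^ p) * cnj (e * g ^ p)) ^ (m + 1)"
    by (simp add: \<eta>_def power_mult_distrib mult_ac flip: power_mult)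
  also have "\<dots> = (N * N) ^ (m + 1)"
    unfolding g(5)[symmetric] by (simp add: N_def mult_ac)
  also have "\<dots> = N ^ p * N" by (simp add: m power_mult power2_eq_square)
  finally have "\<eta> * \<beta> ^ p = N" using N0 by (simp add: \<beta>_def power_divide)
  moreover have "\<beta> \<in> \<O>"
  proof (rule integrally_closed)
    have "N \<in> \<K>" using assms(2) by (auto simp: N_def intro: cyc_int_subset)
    then show "\<beta> \<in> \<K>" using g(1) by (auto simp: \<beta>_def)
    have "\<beta> ^ p = (\<eta> * \<eta>') * \<beta> ^ p" using unit by simp
    also have "\<dots> = \<eta>' * N" using \<open>\<eta> * \<beta> ^ p = N\<close> by (simp add: mult_ac)
    also have "\<dots> \<in> \<O>" using mem assms(2) by (auto simp: N_def)
    finally show "\<beta> ^ p \<in> \<O>" .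
  qed
  ultimately show ?thesis using that real unit mem by (metis N_def)
qed

lemma annihilated_imp_sigma:
  assumes I: "fideal I" and B: "B \<in> \<O>" "B \<noteq> 0" "princ z B = I [^]\<^bsub>IG\<^esub> p"
    and ann: "annihilated z \<sigma> \<mu> (cls I)"
  obtains \<delta> e e' where "\<delta> \<in> \<K>" "\<delta> \<noteq> 0" "e \<in> \<O>" "e' \<in> \<O>" "e * e' = 1" "\<sigma> B = e * (\<delta> ^ p * B ^ \<mu>)"
proof -
  have BK: "B \<in> \<K>" using B by (simp add: cyc_int_subset)
  have "cls (\<sigma> ` I) = cls (I [^]\<^bsub>IG\<^esub> \<mu>)"
    using ann unfolding annihilated_def act_class_eq[OF sigma_aut_coprime I] class_power[OF I] .
  then have "\<sigma> ` I \<in> cls (I [^]\<^bsub>IG\<^esub> \<mu>)"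
    using mem_ideal_class[OF aut_frac[OF sigma_aut_coprime I]] by simp
  then obtain d where d: "d \<in> \<K>" "d \<noteq> 0" "\<sigma> ` I = (*) d ` (I [^]\<^bsub>IG\<^esub> \<mu>)"
    unfolding ideal_class_eq[OF frac_power[OF I]] by blast
  have "princ z (\<sigma> B) = \<sigma> ` princ z B" by (rule aut_princ[OF sigma_aut_coprime BK, symmetric])
  also have "\<dots> = (\<sigma> ` I) [^]\<^bsub>IG\<^esub> p" unfolding B(3) by (rule aut_ideal_power[OF sigma_aut_coprime I])
  also have "\<dots> = (*) (d ^ p) ` ((I [^]\<^bsub>IG\<^esub> \<mu>) [^]\<^bsub>IG\<^esub> p)"
    unfolding d(3) by (rule scale_power[OF frac_power[OF I] d(1,2)])
  also have "(I [^]\<^bsub>IG\<^esub> \<mu>) [^]\<^bsub>IG\<^esub> p = (I [^]\<^bsub>IG\<^esub> p) [^]\<^bsub>IG\<^esub> \<mu>"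
    using I by (simp add: IG.nat_pow_pow mult.commute)
  also have "\<dots> = princ z (B ^ \<mu>)" unfolding B(3)[symmetric] by (rule princ_power[OF BK B(2)])
  also have "(*) (d ^ p) ` princ z (B ^ \<mu>) = princ z (d ^ p * B ^ \<mu>)"
    unfolding princ_eq by (simp add: image_image mult.assoc)
  finally have "princ z (\<sigma> B) = princ z (d ^ p * B ^ \<mu>)" .
  moreover have "d ^ p * B ^ \<mu> \<noteq> 0" using d B by simp
  ultimately obtain e e' where "e \<in> \<O>" "e' \<in> \<O>" "e * e' = 1" "\<sigma> B = e * (d ^ p * B ^ \<mu>)"
    by (rule princ_eq_imp_unit)
  with d show ?thesis using that by blast
qed

text \<open>With \<open>\<delta> = x / y\<close>, every factor of
  \<open>\<sigma> B * y ^ p = B ^ \<mu> * x ^ p * e\<close> other than \<open>e\<close> is an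
  integer prime to \<open>p\<close> modulo \<open>\<pi> ^ 2\<close>, so \<open>e\<close> is an
  integer there as well.\<close>

lemma semi_primary_unit_real:
  assumes B: "B \<in> \<O>" "dv (\<pi>\<^sup>2) (B - of_int c)" "\<not> int p dvd c"
    and d: "\<delta> \<in> \<K>" and e: "e \<in> \<O>" "e' \<in> \<O>" "e * e' = 1" "\<sigma> B = e * (\<delta> ^ p * B ^ \<mu>)"
  shows "cnj e = e"
proof -
  have sB: "\<sigma> B \<in> \<O>" by (rule aut_mem[OF sigma_aut B(1)])
  have sBc: "dv (\<pi>\<^sup>2) (\<sigma> B - of_int c)" by (rule aut_cong_int[OF sigma_aut B(1,2)])
  have pi2: "dv \<pi> (\<pi>\<^sup>2)" by (auto simp: power2_eq_square)
  have nc: "\<not> dv \<pi> (of_int c)" using B(3) by (simp only: pi_dv_int_iff) simp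
  have nB: "\<not> dv \<pi> B" "\<not> dv \<pi> (\<sigma> B)"
    using nc cong_dv_iff dv_trans[OF pi2 B(2)] dv_trans[OF pi2 sBc] by blast+
  have ne: "\<not> dv \<pi> e" using dv_mult_right[of \<pi> e e'] e pi_not_dv_1 by auto
  have neB: "\<not> dv \<pi> (e * B ^ \<mu>)"
    using ne nB(1) pi_prime[OF e(1) power_mem[OF B(1)]] pi_prime_power[OF B(1)] by blast
  have "\<sigma> B = e * B ^ \<mu> * \<delta> ^ p" using e(4) by (simp add: mult_ac)
  then obtain x y where xy: "x \<in> \<O>" "y \<in> \<O>" "\<not> dv \<pi> x" "\<not> dv \<pi> y" "\<delta> = x / y"
    using pi_field_unit[OF sB mult_mem[OF e(1) power_mem[OF B(1)]] nB(2) neB d] by blast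
  obtain a where a: "\<not> int p dvd a" "dv (\<pi> ^ p) (x ^ p - of_int a ^ p)"
    using xy(1,3) by (rule power_p_cong_int)
  obtain b where b: "\<not> int p dvd b" "dv (\<pi> ^ p) (y ^ p - of_int b ^ p)"
    using xy(2,4) by (rule power_p_cong_int)
  have "y \<noteq> 0" using xy(4) by auto
  then have eq: "\<sigma> B * y ^ p = B ^ \<mu> * x ^ p * e"
    using e(4) xy(5) by (simp add: power_divide mult_ac)
  have 1: "dv (\<pi>\<^sup>2) (\<sigma> B * y ^ p - of_int c * of_int b ^ p)"
    using sBc dv_trans[OF pi_square_dv_pi_power_p b(2)] xy(2) by (intro dvc_mult) auto
  have 2: "dv (\<pi>\<^sup>2) (B ^ \<mu> * x ^ p * e - of_int c ^ \<mu> * of_int a ^ p * e)"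
  proof (intro dvc_mult)
    show "dv (\<pi>\<^sup>2) (B ^ \<mu> - of_int c ^ \<mu>)" using B(1,2) by (intro dvc_power) auto
    show "dv (\<pi>\<^sup>2) (x ^ p - of_int a ^ p)" by (rule dv_trans[OF pi_square_dv_pi_power_p a(2)])
  qed (use xy(1) e(1) in auto)
  \<comment> \<open>The integer multiplying \<open>e\<close>. It is inverted modulo \<open>p\<close>
    by Bezout, which is enough because \<open>\<pi> ^ 2\<close> divides \<open>p\<close>.\<close>
  define h where "h = c ^ \<mu> * a ^ p"
  have "prime (int p)" using prime_p by simp
  then have "\<not> int p dvd h"
    unfolding h_def using a(1) B(3) prime_dvd_mult_iff prime_dvd_power by blast
  then have "coprime (int p) h" using prime_p by (simp add: prime_imp_coprime)
  then obtain r s where "r * int p + s * h = 1"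
    by (metis bezout_int coprime_iff_gcd_eq_1)
  then have rs: "(1::complex) = of_int r * of_nat p + of_int s * of_int h"
    by (metis of_int_1 of_int_add of_int_mult of_int_of_nat_eq)
  have "dv (\<pi>\<^sup>2) ((\<sigma> B * y ^ p - of_int c * of_int b ^ p)
      - (\<sigma> B * y ^ p - of_int c ^ \<mu> * of_int a ^ p * e))"
    using 1 2 unfolding eq by (rule dv_diff)
  then have "dv (\<pi>\<^sup>2) (of_int s * (of_int h * e - of_int c * of_int b ^ p))"
    by (intro dv_mult_left) (simp_all add: h_def)
  moreover have "dv (\<pi>\<^sup>2) (of_int r * e * of_nat p)" using pi_square_dv_p e(1) by auto
  ultimately have "dv (\<pi>\<^sup>2) (of_int s * (of_int h * e - of_int c * of_int b ^ p) + of_int r * e * of_nat p)"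
    by (rule dv_add)
  also have "of_int s * (of_int h * e - of_int c * of_int b ^ p) + of_int r * e * of_nat p
      = (of_int r * of_nat p + of_int s * of_int h) * e - of_int (s * (c * b ^ p))"
    by (simp add: algebra_simps)
  finally have "dv (\<pi>\<^sup>2) (e - of_int (s * (c * b ^ p)))" unfolding rs[symmetric] by simp
  then show ?thesis by (rule unit_cong_int_real[OF e(1,3,2)])
qed

lemma sigma_quotient:
  assumes B: "B \<in> \<O>" "B \<noteq> 0" and d: "\<delta> \<in> \<K>" "\<delta> \<noteq> 0"
    and e: "e * e' = 1" "cnj e = e" "\<sigma> B = e * (\<delta> ^ p * B ^ \<mu>)"
    and \<beta>: "\<beta> \<in> \<O>" "\<beta> \<noteq> 0" and B': "B' = B * \<beta> ^ p / cnj B"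
  shows "\<exists>\<alpha>\<in>\<K>. \<sigma> B' = B' ^ \<mu> * \<alpha> ^ p"
proof
  have K: "B \<in> \<K>" "\<beta> \<in> \<K>" "\<beta> ^ p \<in> \<K>" "cnj B \<in> \<K>" "B * \<beta> ^ p \<in> \<K>"
    using B \<beta> by (auto intro!: cyc_int_subset)
  \<comment> \<open>Read off from \<open>B' = (B / cnj B) * \<beta> ^ p\<close>:
    \<open>\<delta> / cnj \<delta>\<close> comes from \<open>\<sigma>\<close> of the quotient,
    \<open>\<sigma> \<beta>\<close> from the factor \<open>\<beta> ^ p\<close>, and
    \<open>\<beta> ^ \<mu>\<close> compensates for that factor in \<open>B' ^ \<mu>\<close>.\<close>
  define \<alpha> where "\<alpha> = \<delta> * \<sigma> \<beta> / (cnj \<delta> * \<beta> ^ \<mu>)"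
  have e0: "e \<noteq> 0" using e(1) by auto
  have "\<sigma> (cnj B) = cnj (\<sigma> B)" by (rule aut_cnj[OF sigma_aut B(1)])
  then have "\<sigma> (cnj B) = e * (cnj \<delta> ^ p * cnj B ^ \<mu>)" using e(2,3) by simp
  then have "\<sigma> B' = e * (\<delta> ^ p * B ^ \<mu>) * \<sigma> \<beta> ^ p / (e * (cnj \<delta> ^ p * cnj B ^ \<mu>))"
    unfolding B' by (simp only: aut_divide[OF sigma_aut K(5,4)] aut_mult[OF sigma_aut K(1,3)]
        aut_power[OF sigma_aut K(2)] e(3))
  also have "\<dots> = (B * \<beta> ^ p / cnj B) ^ \<mu> * \<alpha> ^ p"
    unfolding \<alpha>_def using e0 B(2) d(2) \<beta>(2)
    by (simp add: power_divide power_mult_distrib mult_ac flip: power_mult)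
  finally show "\<sigma> B' = B' ^ \<mu> * \<alpha> ^ p" unfolding B' .
  show "\<alpha> \<in> \<K>" unfolding \<alpha>_def using d(1) K(2) aut_closed[OF galois_sigma K(2)] by auto
qed

text \<open>If \<open>B = x ^ p\<close>, the ideal \<open>I\<close> divided by \<open>x\<close> has
  \<open>p\<close>-th power the unit ideal, so it is the unit ideal and \<open>I\<close> is
  principal.\<close>

lemma not_p_power:
  assumes I: "fideal I" and B: "princ z B = I [^]\<^bsub>IG\<^esub> p" and B0: "B \<noteq> 0"
    and I1: "cls I \<noteq> \<one>\<^bsub>CG\<^esub>"
  shows "\<not> (\<exists>x\<in>\<K>. B = x ^ p)"
proof clarify
  fix x assume x: "x \<in> \<K>" "B = x ^ p"
  with B0 have x0: "x \<noteq> 0" by (auto simp: power_0_left)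
  have ix: "inverse x \<in> \<K>" "inverse x \<noteq> 0" using x x0 by auto
  define J where "J = (*) (inverse x) ` I"
  have J: "fideal J" unfolding J_def by (rule frac_scale[OF I ix])
  have "J [^]\<^bsub>IG\<^esub> p = (*) (inverse x ^ p) ` (*) (x ^ p) ` \<O>"
    unfolding J_def scale_power[OF I ix] B[symmetric] x(2) princ_eq ..
  also have "\<dots> = \<O>" unfolding scale_scale using x0 by (simp flip: power_mult_distrib)
  finally have "J = \<O>" by (rule ideal_power_eq_one[OF J])
  then have "cls I = cls \<O>" unfolding J_def using ideal_class_scale[OF I ix] by simp
  then show False using I1 class_group_one by simp
qed

lemma pi_exponent:
  assumes C: "C \<in> \<O>" "dv (\<pi> ^ p) (\<sigma> C - C ^ \<mu>)" "dv \<pi> (C - 1)" "\<not> dv (\<pi> ^ p) (C - 1)"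
    and \<mu>: "[\<mu> = u ^ n] (mod p)" "0 < n" "n < p - 1"
  shows "dv (\<pi> ^ n) (C - 1)" "\<not> dv (\<pi> ^ Suc n) (C - 1)"
proof -
  have "C - 1 \<noteq> 0" using C(4) by auto
  then obtain k a where a: "a \<in> \<O>" "\<not> dv \<pi> a" "C - 1 = \<pi> ^ k * a"
    using pi_factor[of "C - 1"] C(1) by blast
  have Suc_k: "\<not> dv (\<pi> ^ Suc k) (C - 1)"
  proof
    assume "dv (\<pi> ^ Suc k) (C - 1)"
    then have "dv (\<pi> ^ k * \<pi>) (\<pi> ^ k * a)" unfolding a(3) by (simp only: power_Suc2)
    then have "dv \<pi> a" by (simp only: pi_power_dv_cancel_iff)
    then show False using a(2) by blast
  qed
  have k: "0 < k" using C(3) a(2,3) by (cases k) auto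
  have "k < p"
  proof (rule ccontr)
    assume "\<not> k < p"
    then have "dv (\<pi> ^ p) (\<pi> ^ k)" by (intro dv_power_le) auto
    then have "dv (\<pi> ^ p) (C - 1)" unfolding a(3) using a(1) by (rule dv_mult_right)
    then show False using C(4) by blast
  qed
  \<comment> \<open>The quotient \<open>(1 - z ^ u) / (1 - z)\<close>, which is \<open>u\<close>
    modulo \<open>\<pi>\<close>.\<close>
  define g where "g = (\<Sum>i<u. z ^ i)"
  have g: "g \<in> \<O>" unfolding g_def by (auto intro!: sum_mem)
  have "g - of_nat u = (\<Sum>i<u. z ^ i - 1)" by (simp add: g_def sum_subtractf)
  then have gu: "dv \<pi> (g - of_nat u)" using dv_sum[of "{..<u}"] cong_root_of_unity_1 by simp
  have "z ^ u - 1 = (z - 1) * g" unfolding g_def by (rule power_diff_1_eq)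
  then have "1 - z ^ u = \<pi> * g" by (simp add: algebra_simps)
  moreover have "\<sigma> \<pi> = 1 - z ^ u"
    using aut_add[OF sigma_aut, of \<pi> z] aut_1[OF sigma_aut] sigma_z by (simp add: cyc_int_subset algebra_simps)
  ultimately have spi: "\<sigma> \<pi> = \<pi> * g" by (simp only:)
  have C1: "C = 1 + \<pi> ^ k * a" using a(3) by (simp add: algebra_simps)
  have "\<sigma> (\<pi> ^ k * a) = (\<pi> * g) ^ k * \<sigma> a"
    using a(1) by (simp only: aut_mult[OF sigma_aut] cyc_int_subset power_mem pi_mem aut_power_int[OF sigma_aut] spi)
  then have sC: "\<sigma> C = 1 + \<pi> ^ k * (g ^ k * \<sigma> a)"
    unfolding C1 using a(1) aut_add[OF sigma_aut, of 1 "\<pi> ^ k * a"] aut_1[OF sigma_aut]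
    by (simp add: cyc_int_subset power_mult_distrib mult.assoc)
  obtain s where s: "s \<in> \<O>"
    "C ^ \<mu> = 1 + of_nat \<mu> * (\<pi> ^ k * a) + (\<pi> ^ k * a)\<^sup>2 * s"
    using binomial_remainder[of "\<pi> ^ k * a" \<mu>] a(1) C1 by auto
  have "\<sigma> C - C ^ \<mu> = \<pi> ^ k * (g ^ k * \<sigma> a - of_nat \<mu> * a - \<pi> ^ k * (a\<^sup>2 * s))"
    unfolding sC s(2) by (simp add: algebra_simps power2_eq_square)
  \<comment> \<open>Because \<open>k < p\<close>, the congruence modulo \<open>\<pi> ^ p\<close>
    still leaves one factor \<open>\<pi>\<close> after division by \<open>\<pi> ^ k\<close>.\<close>
  moreover have "dv (\<pi> ^ k * \<pi>) (\<sigma> C - C ^ \<mu>)"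
  proof -
    have "dv (\<pi> ^ Suc k) (\<pi> ^ p)" using \<open>k < p\<close> by (intro dv_power_le) auto
    then show ?thesis using C(2) dv_trans by (simp only: power_Suc2)
  qed
  ultimately have 1: "dv \<pi> (g ^ k * \<sigma> a - of_nat \<mu> * a - \<pi> ^ k * (a\<^sup>2 * s))"
    by (simp only: pi_power_dv_cancel_iff)
  have "dv \<pi> (\<pi> ^ k)" using dv_power_le[of 1 k \<pi>] k by simp
  then have "dv \<pi> (\<pi> ^ k * (a\<^sup>2 * s))" using a(1) s(1) by auto
  from dv_add[OF 1 this] have 2: "dv \<pi> (g ^ k * \<sigma> a - of_nat \<mu> * a)" by simp
  have 3: "dv \<pi> (g ^ k * \<sigma> a - of_nat u ^ k * a)"
  proof (rule dvc_mult)
    show "dv \<pi> (g ^ k - of_nat u ^ k)" using gu g by (intro dvc_power) auto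
    obtain b where b: "dv \<pi> (a - of_int b)" using a(1) by (rule cong_int_mod_pi)
    then have "dv \<pi> (\<sigma> a - of_int b)" using aut_cong_int[OF sigma_aut a(1), of 1 b] by simp
    then show "dv \<pi> (\<sigma> a - a)" using b dv_minus_commute dvc_trans by blast
  qed (use aut_mem[OF sigma_aut a(1)] in auto)
  have "dv \<pi> ((g ^ k * \<sigma> a - of_nat \<mu> * a) - (g ^ k * \<sigma> a - of_nat u ^ k * a))"
    using 2 3 by (rule dv_diff)
  also have "(g ^ k * \<sigma> a - of_nat \<mu> * a) - (g ^ k * \<sigma> a - of_nat u ^ k * a)
      = of_int (int u ^ k - int \<mu>) * a"
    by (simp add: algebra_simps)
  finally have "dv \<pi> (of_int (int u ^ k - int \<mu>))" using a(1,2) by (simp only: pi_prime of_int_mem) simp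
  then have "int p dvd int u ^ k - int \<mu>" by (simp only: pi_dv_int_iff)
  then have "[int (u ^ k) = int \<mu>] (mod int p)" by (simp add: cong_iff_dvd_diff)
  then have "[u ^ k = \<mu>] (mod p)" by (simp only: cong_int_iff)
  then have "[u ^ k = u ^ n] (mod p)" using \<mu>(1) cong_trans by blast
  then have kn: "[k = n] (mod (p - 1))" using order_divides_expdiff[OF coprime_p_u] ord_u by simp
  \<comment> \<open>Both exponents lie between 1 and \<open>p - 1\<close> and agree modulo
    \<open>p - 1\<close>; the value \<open>k = p - 1\<close> would make \<open>n\<close> a multiple
    of \<open>p - 1\<close>.\<close>
  have "k = n"
  proof (cases "k = p - 1")
    case True
    then show ?thesis using kn \<mu>(2,3) by (simp add: cong_def)
  next
    case False
    then have "k < p - 1" using \<open>k < p\<close> by simp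
    then show ?thesis using kn \<mu>(3) by (simp add: cong_def)
  qed
  then show "dv (\<pi> ^ n) (C - 1)" "\<not> dv (\<pi> ^ Suc n) (C - 1)"
    using Suc_k a(1,3) by auto
qed

text \<open>For \<open>\<alpha> = x / y\<close> with \<open>x\<close> and \<open>y\<close> prime to
  \<open>\<pi>\<close>, the exponent \<open>p - 1\<close> turns \<open>x ^ p\<close> and
  \<open>y ^ p\<close> into \<open>p\<close>-th powers of numbers that are 1 modulo
  \<open>\<pi>\<close>, hence into 1 modulo \<open>\<pi> ^ p\<close>.\<close>

lemma sigma_cong_power:
  assumes B: "B \<in> \<O>" "\<not> dv \<pi> B" and \<alpha>: "\<alpha> \<in> \<K>" "\<sigma> B = B ^ \<mu> * \<alpha> ^ p"
  shows "dv (\<pi> ^ p) (\<sigma> (B ^ (p - 1)) - (B ^ (p - 1)) ^ \<mu>)"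
proof -
  have sB: "\<sigma> B \<in> \<O>" by (rule aut_mem[OF sigma_aut B(1)])
  obtain b where b: "dv \<pi> (B - of_int b)" using B(1) by (rule cong_int_mod_pi)
  then have "dv \<pi> (\<sigma> B - of_int b)" using aut_cong_int[OF sigma_aut B(1), of 1 b] by simp
  then have nsB: "\<not> dv \<pi> (\<sigma> B)" using b B(2) cong_dv_iff by blast
  have "\<not> dv \<pi> (B ^ \<mu>)" using B pi_prime_power by blast
  then obtain x y where xy: "x \<in> \<O>" "y \<in> \<O>" "\<not> dv \<pi> x" "\<not> dv \<pi> y" "\<alpha> = x / y"
    using pi_field_unit[OF sB power_mem[OF B(1)] nsB _ \<alpha>] by blast
  have "y \<noteq> 0" using xy(4) by auto
  then have "\<sigma> B * y ^ p = B ^ \<mu> * x ^ p" unfolding \<alpha>(2) xy(5) by (simp add: power_divide)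
  then have "(\<sigma> B * y ^ p) ^ (p - 1) = (B ^ \<mu> * x ^ p) ^ (p - 1)" by simp
  then have eq: "\<sigma> B ^ (p - 1) * (y ^ (p - 1)) ^ p = (B ^ (p - 1)) ^ \<mu> * (x ^ (p - 1)) ^ p"
    by (simp add: power_mult_distrib mult.commute flip: power_mult)
  have 1: "dv (\<pi> ^ p) ((w ^ (p - 1)) ^ p - 1)" if "w \<in> \<O>" "\<not> dv \<pi> w" for w
    using cong_power_p[OF cong_1_power_p_minus_1[OF that] one_mem] by simp
  have "dv (\<pi> ^ p) (\<sigma> B ^ (p - 1) * ((y ^ (p - 1)) ^ p - 1))" using sB 1[OF xy(2,4)] by auto
  moreover have "dv (\<pi> ^ p) ((B ^ (p - 1)) ^ \<mu> * ((x ^ (p - 1)) ^ p - 1))" using B(1) 1[OF xy(1,3)] by auto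
  ultimately have "dv (\<pi> ^ p) ((B ^ (p - 1)) ^ \<mu> * ((x ^ (p - 1)) ^ p - 1)
      - \<sigma> B ^ (p - 1) * ((y ^ (p - 1)) ^ p - 1))" by (intro dv_diff)
  also have "(B ^ (p - 1)) ^ \<mu> * ((x ^ (p - 1)) ^ p - 1) - \<sigma> B ^ (p - 1) * ((y ^ (p - 1)) ^ p - 1)
      = \<sigma> B ^ (p - 1) - (B ^ (p - 1)) ^ \<mu>"
    using eq by (simp only: right_diff_distrib) simp
  finally show ?thesis by (simp only: aut_power_int[OF sigma_aut B(1)])
qed

lemma primary_if_cong:
  assumes B: "B \<in> \<O>" "\<not> dv \<pi> B" "singular p z B" and C: "dv (\<pi> ^ p) (B ^ (p - 1) - 1)"
  shows "primary p z B"
proof -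
  obtain b where b: "\<not> int p dvd b" "dv (\<pi> ^ p) (B ^ p - of_int b ^ p)"
    using B(1,2) by (rule power_p_cong_int)
  have "dv (\<pi> ^ p) (B * (B ^ (p - 1) - 1))" using C B(1) by auto
  also have "B * (B ^ (p - 1) - 1) = B ^ p - B" by (simp only: power_p[of B] right_diff_distrib mult_1_right)
  finally have "dv (\<pi> ^ p) (B ^ p - B)" .
  then have "dv (\<pi> ^ p) (B - of_int b ^ p)" using b(2) dv_minus_commute dvc_trans by blast
  then have "cong_pi z p B (of_int b ^ p)"
    unfolding cong_pi_def using B(1) by (subst pi_power_loc_iff) auto
  then show ?thesis unfolding primary_def using b(1) B(3) by blast
qed

lemma square_annihilated:
  assumes I: "fideal I" "annihilated z \<sigma> \<mu> (cls I)"
  shows "annihilated z \<sigma> \<mu> (cls (I [^]\<^bsub>IG\<^esub> (2::nat)))"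
proof -
  have c: "cls I \<in> carrier CG" using I by (auto simp: class_group_carrier)
  have "act_class \<sigma> (cls (I [^]\<^bsub>IG\<^esub> (2::nat))) = cls (\<sigma> ` I) [^]\<^bsub>CG\<^esub> (2::nat)"
    by (simp only: act_class_eq[OF sigma_aut_coprime frac_power[OF I(1)]] aut_ideal_power[OF sigma_aut_coprime I(1)]
        class_power[OF aut_frac[OF sigma_aut_coprime I(1)]])
  also have "cls (\<sigma> ` I) = cls I [^]\<^bsub>CG\<^esub> \<mu>"
    using I(2) unfolding annihilated_def act_class_eq[OF sigma_aut_coprime I(1)] .
  also have "(cls I [^]\<^bsub>CG\<^esub> \<mu>) [^]\<^bsub>CG\<^esub> (2::nat) = (cls I [^]\<^bsub>CG\<^esub> (2::nat)) [^]\<^bsub>CG\<^esub> \<mu>"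
    using c by (simp add: CG.nat_pow_pow mult.commute)
  finally show ?thesis unfolding annihilated_def class_power[OF I(1), symmetric] .
qed

text \<open>Both inverses are expressed as \<open>(p - 1)\<close>-st powers, and powers commute with
  squaring.\<close>

lemma square_minus:
  assumes I: "fideal I" "cls I \<in> class_p_minus p z"
  shows "cls (I [^]\<^bsub>IG\<^esub> (2::nat)) \<in> class_p_minus p z"
proof -
  define c where "c = cls I"
  have c: "c \<in> carrier CG" "act_class cnj c = inv\<^bsub>CG\<^esub> c" "c [^]\<^bsub>CG\<^esub> p = \<one>\<^bsub>CG\<^esub>"
    using I(2) unfolding class_p_minus_def class_p_def c_def by auto
  define c2 where "c2 = c [^]\<^bsub>CG\<^esub> (2::nat)"
  have c2: "cls (I [^]\<^bsub>IG\<^esub> (2::nat)) = c2" "c2 \<in> carrier CG"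
    unfolding c2_def using CG.nat_pow_closed[OF c(1), of 2] by (simp_all only: c_def class_power[OF I(1)])
  obtain n where n: "p = Suc n" using p_gt_0 gr0_implies_Suc by blast
  have inv_c: "c [^]\<^bsub>CG\<^esub> n = inv\<^bsub>CG\<^esub> c"
    using c(1,3) CG.m_comm by (intro CG.inv_unique') (auto simp: n)
  have c2p: "c2 [^]\<^bsub>CG\<^esub> p = \<one>\<^bsub>CG\<^esub>"
  proof -
    have "c2 [^]\<^bsub>CG\<^esub> p = (c [^]\<^bsub>CG\<^esub> p) [^]\<^bsub>CG\<^esub> (2::nat)"
      unfolding c2_def using c(1) by (simp add: CG.nat_pow_pow mult.commute del: CG.nat_pow_Suc nat_pow_Suc)
    then show ?thesis using c(3) by simp
  qed
  have inv_c2: "c2 [^]\<^bsub>CG\<^esub> n = inv\<^bsub>CG\<^esub> c2"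
    using c2(2) c2p CG.m_comm by (intro CG.inv_unique') (auto simp: n)
  have "act_class cnj c2 = cls (cnj ` I) [^]\<^bsub>CG\<^esub> (2::nat)"
    by (simp only: act_class_eq[OF cnj_aut_coprime frac_power[OF I(1)]] aut_ideal_power[OF cnj_aut_coprime I(1)]
        class_power[OF aut_frac[OF cnj_aut_coprime I(1)]] c2(1)[symmetric])
  also have "cls (cnj ` I) = c [^]\<^bsub>CG\<^esub> n"
    using c(2) inv_c unfolding c_def act_class_eq[OF cnj_aut_coprime I(1)] by (simp only:)
  also have "(c [^]\<^bsub>CG\<^esub> n) [^]\<^bsub>CG\<^esub> (2::nat) = c2 [^]\<^bsub>CG\<^esub> n"
    unfolding c2_def using c(1) by (simp add: CG.nat_pow_pow mult.commute del: CG.nat_pow_Suc nat_pow_Suc)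
  finally show ?thesis
    unfolding c2(1) class_p_minus_def class_p_def using c2 c2p inv_c2 by simp
qed

lemma singular_negative_decomposition:
  assumes "B \<in> \<O>" "semi_primary p z B" "fideal I" "princ z B = I [^]\<^bsub>IG\<^esub> p"
    and "cls I \<in> class_p_minus p z" "has_order CG (cls I) p" "annihilated z \<sigma> \<mu> (cls I)"
    and "\<mu> = u ^ n mod p" "0 < n" "n < p - 1"
  shows "\<exists>\<eta>\<in>units_in (real_cyc_int z). \<exists>\<beta>\<in>\<O>.
           B * cnj B = \<eta> * \<beta> ^ p \<and>
           (let B' = B ^ 2 / \<eta> in
              singular_negative_integer p z \<sigma> B' \<and>
              (\<exists>\<alpha>\<in>\<K>. \<sigma> B' = B' ^ \<mu> * \<alpha> ^ p) \<and>
              (\<not> primary p z B' \<longrightarrow> pi_exactly z n (B' ^ (p - 1) - 1)))"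
proof -
  note B = assms(1) and I = assms(3)
  have "singular p z B" using assms(2) by (simp add: semi_primary_def)
  then have np: "\<not> (\<exists>x\<in>\<K>. B = x ^ p)" by (simp add: singular_def)
  then have B0: "B \<noteq> 0" using K.zero_mem power_0_left[of p] by (metis p_neq_0)
  obtain c where c: "\<not> int p dvd c" "dv (\<pi>\<^sup>2) (B - of_int c)"
    using assms(2) B unfolding semi_primary_def cong_pi_def by (auto simp: pi_power_loc_iff)
  obtain \<eta> \<eta>' \<beta> where eta: "\<eta> \<in> real_cyc_int z" "\<eta>' \<in> real_cyc_int z" "\<eta> * \<eta>' = 1"
    "\<eta> \<in> \<O>" "\<eta>' \<in> \<O>" and beta: "\<beta> \<in> \<O>" "B * cnj B = \<eta> * \<beta> ^ p"
    using I B B0 assms(4,5) by (rule minus_class_norm_real)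
  obtain \<delta> e e' where d: "\<delta> \<in> \<K>" "\<delta> \<noteq> 0"
    and e: "e \<in> \<O>" "e' \<in> \<O>" "e * e' = 1" "\<sigma> B = e * (\<delta> ^ p * B ^ \<mu>)"
    using I B B0 assms(4,7) by (rule annihilated_imp_sigma)
  have real_e: "cnj e = e" using B c(2,1) d(1) e by (rule semi_primary_unit_real)
  define B' where "B' = B\<^sup>2 / \<eta>"
  have eta0: "\<eta> \<noteq> 0" using eta(3) by auto
  have beta0: "\<beta> \<noteq> 0" using beta(2) B0 by (auto simp: power_0_left)
  have B'_eta': "B' = \<eta>' * B\<^sup>2" using eta(3) eta0 by (simp add: B'_def field_simps)
  have B'0: "B' \<noteq> 0" using B0 eta0 by (simp add: B'_def)
  have B'_mem: "B' \<in> \<O>" unfolding B'_eta' using eta B by auto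
  have "B' = B * \<beta> ^ p / cnj B"
    using beta(2) eta0 B0 by (simp add: B'_def field_simps power2_eq_square)
  then obtain \<alpha> where alpha: "\<alpha> \<in> \<K>" "\<sigma> B' = B' ^ \<mu> * \<alpha> ^ p"
    using sigma_quotient[OF B B0 d e(3) real_e e(4) beta(1) beta0] by blast
  \<comment> \<open>\<open>\<eta>\<close> is a unit, so \<open>B'\<close> generates the same ideal
    as the square of \<open>B\<close>, namely the \<open>p\<close>-th power of this
    \<open>J\<close>.\<close>
  define J where "J = I [^]\<^bsub>IG\<^esub> (2::nat)"
  have J: "fideal J" unfolding J_def by (rule frac_power[OF I])
  have BK: "B \<in> \<K>" using B by (rule cyc_int_subset)
  have "princ z B' = princ z (B\<^sup>2)"
    unfolding B'_eta' using eta by (intro unit_princ[of _ \<eta>]) (auto simp: mult.commute)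
  also have "\<dots> = (I [^]\<^bsub>IG\<^esub> p) [^]\<^bsub>IG\<^esub> (2::nat)"
    unfolding assms(4)[symmetric] by (rule princ_power[OF BK B0, symmetric])
  also have "\<dots> = J [^]\<^bsub>IG\<^esub> p"
    unfolding J_def using I by (simp add: IG.nat_pow_pow mult.commute del: IG.nat_pow_Suc nat_pow_Suc)
  finally have princ_B': "princ z B' = J [^]\<^bsub>IG\<^esub> p" .
  \<comment> \<open>The class of \<open>I\<close> has odd order \<open>p\<close>, so its square is
    nontrivial, and by \<open>not_p_power\<close> this keeps \<open>B'\<close> from being a
    \<open>p\<close>-th power.\<close>
  have "cls J \<noteq> \<one>\<^bsub>CG\<^esub>"
  proof
    assume "cls J = \<one>\<^bsub>CG\<^esub>"
    then have "cls I [^]\<^bsub>CG\<^esub> (2::nat) = \<one>\<^bsub>CG\<^esub>" by (simp only: class_power[OF I] J_def)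
    then have "p dvd 2" using assms(6) unfolding has_order_def by blast
    then show False using p_ge_3 by (auto dest: dvd_imp_le)
  qed
  then have sing: "singular p z B'"
    unfolding singular_def
    using not_p_power[OF J princ_B' B'0] J princ_B' cyc_int_subset[OF B'_mem] by blast
  have coprime_mu: "\<mu> \<in> {1..p - 1}"
  proof -
    have "\<not> p dvd u ^ n" using not_p_dvd_u prime_p prime_dvd_power by blast
    then have "\<mu> \<noteq> 0" using assms(8) by (simp add: dvd_eq_mod_eq_0)
    moreover have "\<mu> < p" using assms(8) by simp
    ultimately show ?thesis by simp
  qed
  have neg: "singular_negative_integer p z \<sigma> B'"
    unfolding singular_negative_integer_def
    using sing B'_mem J princ_B' coprime_mu square_annihilated[OF I assms(7)]
      square_minus[OF I assms(5)] unfolding J_def by blast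
  have nB: "\<not> dv \<pi> B'"
  proof
    assume "dv \<pi> B'"
    then have "dv \<pi> (B' * \<eta>)" using eta(4) by (rule dv_mult_right)
    then have "dv \<pi> (B\<^sup>2)" using eta0 by (simp add: B'_def)
    then have "dv \<pi> B" by (rule pi_prime_power[OF B])
    moreover have "dv \<pi> (\<pi>\<^sup>2)" by (auto simp: power2_eq_square)
    ultimately have "dv \<pi> (of_int c)" using c(2) cong_dv_iff dv_trans by blast
    then show False using c(1) by (simp only: pi_dv_int_iff)
  qed
  have exact: "pi_exactly z n (B' ^ (p - 1) - 1)" if "\<not> primary p z B'"
  proof -
    define C where "C = B' ^ (p - 1)"
    have C: "C \<in> \<O>" "C - 1 \<in> \<O>" using B'_mem by (auto simp: C_def)
    have "[\<mu> = u ^ n] (mod p)" using assms(8) by (simp add: cong_def)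
    moreover have "dv (\<pi> ^ p) (\<sigma> C - C ^ \<mu>)"
      unfolding C_def by (rule sigma_cong_power[OF B'_mem nB alpha])
    moreover have "dv \<pi> (C - 1)" unfolding C_def by (rule cong_1_power_p_minus_1[OF B'_mem nB])
    moreover have "\<not> dv (\<pi> ^ p) (C - 1)"
      using primary_if_cong[OF B'_mem nB sing] that unfolding C_def by blast
    ultimately have "dv (\<pi> ^ n) (C - 1)" "\<not> dv (\<pi> ^ Suc n) (C - 1)"
      using pi_exponent[OF C(1)] assms(9,10) by blast+
    then show ?thesis unfolding pi_exactly_def C_def[symmetric] 
      by (simp only: pi_power_loc_iff[OF C(2)] simp_thms)
  qed
  have "\<eta> \<in> units_in (real_cyc_int z)" unfolding units_in_def using eta by blast
  then show ?thesis
    using beta neg alpha exact unfolding Let_def B'_def by blast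
qed

end

theorem theorem2p4:
  fixes p u m \<mu> :: nat
    and z B :: complex
    and \<sigma> :: "complex \<Rightarrow> complex"
    and I :: "complex set"
  assumes "prime p" and "odd p"
    and "z ^ p = 1" and "z \<noteq> 1"
    and "residue_primroot p u"
    and "galois_aut z \<sigma>" and "\<sigma> z = z ^ u"
    and "B \<in> cyc_int z"
    and "singular p z B"
    and "semi_primary p z B"
    and "fractional_ideal z I"
    and "princ z B = I [^]\<^bsub>ideal_group z\<^esub> p"
    and "ideal_class z I \<in> class_p_minus p z"
    and "has_order (class_group z) (ideal_class z I) p"
    and "annihilated z \<sigma> \<mu> (ideal_class z I)"
    and "\<mu> = u ^ (2 * m + 1) mod p"
    and "1 \<le> m" and "m \<le> (p - 3) div 2"
  shows "\<exists>\<eta>\<in>units_in (real_cyc_int z). \<exists>\<beta>\<in>cyc_int z.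
           B * cnj B = \<eta> * \<beta> ^ p \<and>
           (let B' = B ^ 2 / \<eta> in
              singular_negative_integer p z \<sigma> B' \<and>
              (\<exists>\<alpha>\<in>cyc_field z. \<sigma> B' = B' ^ \<mu> * \<alpha> ^ p) \<and>
              (\<not> primary p z B' \<longrightarrow> pi_exactly z (2 * m + 1) (B' ^ (p - 1) - 1)))"
proof -
  interpret cyclotomic p u z \<sigma>
    by unfold_locales (use assms in auto)
  have "2 * m + 1 < p - 1" using assms(17,18) by linarith
  then show ?thesis
    using singular_negative_decomposition[OF assms(8,10-16)] by simp
qed

end
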